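(* Let $n\ge 2$ and $1<p<\infty$. For the Stokes equations $$u_t-\Delta u+\nabla\pi=0,\qquad \operatorname{div}u=0\quad\text{in } B_2^+\times(0,4),$$ and likewise for the Navier-Stokes equations $$u_t-\Delta u+(u\cdot\nabla)u+\nabla\pi=0,\qquad \operatorname{div}u=0\quad\text{in } B_2^+\times(0,4),$$ there exists a very weak solution $u$ with the no-slip condition $u=0$ on the flat boundary $\Sigma=(B_2\cap\{x_n=0\})\times(0,4)$ such that $$\|u\|_{L^\infty(Q_1^+)}<\infty,\qquad \|\nabla u\|_{L^p(Q_{1/2}^+)}=\infty .$$
   Context: Notation: $x=(x',x_n)\in\mathbb R^{n-1}\times\mathbb R$, $B_r=\{x\in\mathbb R^n:|x|<r\}$, $B_r^+=\{x\in\mathbb R^n: |x|<r,\ x_n>0\}$, $Q_r^+=B_r^+\times(1-r^2,1)$. The statement $\|\nabla u\|_{L^p(Q^+_{1/2})}=\infty$ means that the distributional gradient $\nabla u$ is not in $L^p(Q_{1/2}^+)$. Very weak solutions are distributional solutions tested against divergence-free fields vanishing on the flat boundary. Put $D=B_2^+\cup(B_2\cap\{x_n=0\})$. A vector field $u\in L^1_{\rm loc}(D\times(0,4))$ (for Navier-Stokes: $u\in L^2_{\rm loc}(D\times (0,4))$) is a very weak solution of the Stokes (resp. Navier-Stokes) equations in $B_2^+\times(0,4)$ with $u=0$ on $\Sigma$ if $$-\int_0^4\!\!\int_{B_2^+}u\cdot\Delta\Phi\,dx\,dt=\int_0^4\!\!\int_{B_2^+}u\cdot\Phi_t\,dx\,dt\qquad\Big(\text{resp.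 } =\int_0^4\!\!\int_{B_2^+}\big(u\cdot\Phi_t+(u\otimes u):\nabla\Phi\big)\,dx\,dt\Big)$$ for every vector field $\Phi\in C^2_c(D\times(0,4))$ with $\operatorname{div}\Phi=0$ and $\Phi=0$ on $\{x_n=0\}$, and if in addition $\int_{B_2^+}u(x,t)\cdot\nabla\Psi(x)\,dx=0$ for all $t\in(0,4)$ and every $\Psi\in C^1_c(D)$ with $\Psi=0$ on $\{x_n=0\}$. *)

theory Defs
  imports "HOL-Analysis.Analysis" "HOL-Probability.Essential_Supremum"
begin

section \<open>Derivatives and function spaces\<close>

text \<open>
  Directional derivative relative to a set S.  It is only used for sets S that are open, or convex
  with nonempty interior, where the derivative within S is unique; at boundary points belonging to S
  it is the one-sided derivative.
\<close>

definition dir_deriv ::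
  "'a set \<Rightarrow> 'a::real_normed_vector \<Rightarrow> ('a \<Rightarrow> 'b::real_normed_vector) \<Rightarrow> 'a \<Rightarrow> 'b"
  where "dir_deriv S v f = (\<lambda>z. frechet_derivative f (at z within S) v)"

primrec Ck_on ::
  "nat \<Rightarrow> 'a::real_normed_vector set \<Rightarrow> ('a \<Rightarrow> 'b::real_normed_vector) \<Rightarrow> bool"
  where
    "Ck_on 0 S f \<longleftrightarrow> continuous_on S f"
  | "Ck_on (Suc k) S f \<longleftrightarrow> f differentiable_on S \<and> (\<forall>v. Ck_on k S (dir_deriv S v f))"

definition compact_support_in ::
  "'a::topological_space set \<Rightarrow> ('a \<Rightarrow> 'b::zero) \<Rightarrow> bool"
  where "compact_support_in S f \<longleftrightarrow> (\<exists>K. compact K \<and> K \<subseteq> S \<and> (\<forall>z\<in>S - K. f z = 0))"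

definition in_Lp ::
  "real \<Rightarrow> 'a::euclidean_space set \<Rightarrow> ('a \<Rightarrow> 'b::euclidean_space) \<Rightarrow> bool"
  where "in_Lp p S f \<longleftrightarrow>
    set_borel_measurable lebesgue S f \<and> set_integrable lebesgue S (\<lambda>z. norm (f z) powr p)"

definition in_Lp_loc ::
  "real \<Rightarrow> 'a::euclidean_space set \<Rightarrow> ('a \<Rightarrow> 'b::euclidean_space) \<Rightarrow> bool"
  where "in_Lp_loc p S f \<longleftrightarrow> (\<forall>K. compact K \<and> K \<subseteq> S \<longrightarrow> in_Lp p K f)"

definition Linf_norm :: "'a::euclidean_space set \<Rightarrow> ('a \<Rightarrow> 'b::euclidean_space) \<Rightarrow> ereal"
  where "Linf_norm S f = esssup (lebesgue_on S) (\<lambda>z. ereal (norm (f z)))"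

section \<open>Differential operators in space-time\<close>

text \<open>
  Space-time points are pairs z = (x, t) with x in the Euclidean space 'a; the sums run over the
  standard orthonormal basis of 'a, so derivatives are taken in the space variables only, except
  for the time derivative.
\<close>

definition time_deriv ::
  "('a::euclidean_space \<times> real) set \<Rightarrow> ('a \<times> real \<Rightarrow> 'b::real_normed_vector) \<Rightarrow> 'a \<times> real \<Rightarrow> 'b"
  where "time_deriv S f = dir_deriv S (0, 1) f"

definition space_deriv ::
  "('a::euclidean_space \<times> real) set \<Rightarrow> 'a \<Rightarrow> ('a \<times> real \<Rightarrow> 'b::real_normed_vector) \<Rightarrow> 'a \<times> real \<Rightarrow> 'b"
  where "space_deriv S i f = dir_deriv S (i, 0) f"

definition divergence ::
  "('a::euclidean_space \<times> real) set \<Rightarrow> ('a \<times> real \<Rightarrow> 'a) \<Rightarrow> 'a \<times> real \<Rightarrow> real"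
  where "divergence S f z = (\<Sum>i\<in>Basis. space_deriv S i f z \<bullet> i)"

definition laplacian ::
  "('a::euclidean_space \<times> real) set \<Rightarrow> ('a \<times> real \<Rightarrow> 'b::real_normed_vector) \<Rightarrow> 'a \<times> real \<Rightarrow> 'b"
  where "laplacian S f z = (\<Sum>i\<in>Basis. space_deriv S i (space_deriv S i f) z)"

definition gradient :: "'a::euclidean_space set \<Rightarrow> ('a \<Rightarrow> real) \<Rightarrow> 'a \<Rightarrow> 'a"
  where "gradient S f x = (\<Sum>i\<in>Basis. dir_deriv S i f x *\<^sub>R i)"

text \<open>The contraction of v \<otimes> v with the spatial gradient of f.\<close>

definition tensor_contract ::
  "('a::euclidean_space \<times> real) set \<Rightarrow> 'a \<Rightarrow> ('a \<times> real \<Rightarrow> 'a) \<Rightarrow> 'a \<times> real \<Rightarrow> real"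
  where "tensor_contract S v f z =
    (\<Sum>i\<in>Basis. \<Sum>j\<in>Basis. (v \<bullet> i) * (v \<bullet> j) * (space_deriv S i f z \<bullet> j))"

text \<open>
  The distributional spatial gradient of u on the open set W belongs to Lp: every distributional
  derivative in a space direction i is represented by a (vector-valued) Lp function G i.
\<close>

definition weak_gradient_in_Lp ::
  "real \<Rightarrow> ('a::euclidean_space \<times> real) set \<Rightarrow> ('a \<times> real \<Rightarrow> 'a) \<Rightarrow> bool"
  where "weak_gradient_in_Lp p W u \<longleftrightarrow>
    (\<exists>G. \<forall>i\<in>Basis. in_Lp p W (G i) \<and>
      (\<forall>\<phi>::'a \<times> real \<Rightarrow> real. (\<forall>k. Ck_on k W \<phi>) \<and> compact_support_in W \<phi> \<longrightarrow>
        (LINT z:W|lebesgue. space_deriv W i \<phi> z *\<^sub>R u z)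
          = - (LINT z:W|lebesgue. \<phi> z *\<^sub>R G i z)))"

section \<open>The half balls and very weak solutions\<close>

text \<open>
  R^n is represented as R^(n-1) x R with points x = (x', x_n), so that x_n is snd x and
  n = CARD('m) + 1; the norm of the product type is the Euclidean one.
  Since index types are nonempty, n ranges over exactly the integers n >= 2.
\<close>

type_synonym 'm pt = "(real ^ 'm) \<times> real"

definition half_ball :: "real \<Rightarrow> ('m::finite) pt set"
  where "half_ball r = {x. norm x < r \<and> snd x > 0}"

definition half_cyl :: "real \<Rightarrow> (('m::finite) pt \<times> real) set"
  where "half_cyl r = half_ball r \<times> {1 - r\<^sup>2<..<1}"

definition dom_D :: "('m::finite) pt set"
  where "dom_D = half_ball 2 \<union> (ball 0 2 \<inter> {x. snd x = 0})"

definition dom_DT :: "(('m::finite) pt \<times> real) set"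
  where "dom_DT = dom_D \<times> {0<..<4}"

definition test_field :: "(('m::finite) pt \<times> real \<Rightarrow> 'm pt) \<Rightarrow> bool"
  where "test_field \<Phi> \<longleftrightarrow>
    Ck_on 2 dom_DT \<Phi> \<and> compact_support_in dom_DT \<Phi> \<and>
    (\<forall>z\<in>dom_DT. divergence dom_DT \<Phi> z = 0) \<and>
    (\<forall>(x, t)\<in>dom_DT. snd x = 0 \<longrightarrow> \<Phi> (x, t) = 0)"

text \<open>
  The slice condition holds for every t, not just almost every t.  Since the Isabelle integral of a
  non-integrable function is 0, integrability of the slice integrand is required explicitly.
\<close>

definition weakly_div_free :: "(('m::finite) pt \<times> real \<Rightarrow> 'm pt) \<Rightarrow> bool"
  where "weakly_div_free u \<longleftrightarrow>
    (\<forall>t\<in>{0<..<4}. \<forall>\<Psi>::'m pt \<Rightarrow> real.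
      Ck_on 1 dom_D \<Psi> \<and> compact_support_in dom_D \<Psi> \<and> (\<forall>x\<in>dom_D. snd x = 0 \<longrightarrow> \<Psi> x = 0) \<longrightarrow>
        set_integrable lebesgue (half_ball 2) (\<lambda>x. u (x, t) \<bullet> gradient dom_D \<Psi> x) \<and>
        (LINT x:half_ball 2|lebesgue. u (x, t) \<bullet> gradient dom_D \<Psi> x) = 0)"

definition very_weak_stokes :: "(('m::finite) pt \<times> real \<Rightarrow> 'm pt) \<Rightarrow> bool"
  where "very_weak_stokes u \<longleftrightarrow>
    in_Lp_loc 1 dom_DT u \<and>
    (\<forall>\<Phi>. test_field \<Phi> \<longrightarrow>
      - (LINT t:{0<..<4}|lebesgue. LINT x:half_ball 2|lebesgue.
            u (x, t) \<bullet> laplacian dom_DT \<Phi> (x, t))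
      = (LINT t:{0<..<4}|lebesgue. LINT x:half_ball 2|lebesgue.
            u (x, t) \<bullet> time_deriv dom_DT \<Phi> (x, t))) \<and>
    weakly_div_free u"

definition very_weak_navier_stokes :: "(('m::finite) pt \<times> real \<Rightarrow> 'm pt) \<Rightarrow> bool"
  where "very_weak_navier_stokes u \<longleftrightarrow>
    in_Lp_loc 2 dom_DT u \<and>
    (\<forall>\<Phi>. test_field \<Phi> \<longrightarrow>
      - (LINT t:{0<..<4}|lebesgue. LINT x:half_ball 2|lebesgue.
            u (x, t) \<bullet> laplacian dom_DT \<Phi> (x, t))
      = (LINT t:{0<..<4}|lebesgue. LINT x:half_ball 2|lebesgue.
            u (x, t) \<bullet> time_deriv dom_DT \<Phi> (x, t)
            + tensor_contract dom_DT (u (x, t)) \<Phi> (x, t))) \<and>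
    weakly_div_free u"

end

theory Submission
  imports Defs "HOL-Computational_Algebra.Polynomial"
begin

text \<open>
  The solution is a shear flow \<open>u(x, t) = V(x\<^sub>n, t) e\<close> with \<open>e\<close> a tangential basis vector.  For such a
  flow the convection term vanishes and \<open>div u = 0\<close>, and every \<open>V\<close> with \<open>V(0, t) = 0\<close> and
  \<open>V\<^sub>t - V\<^sub>x\<^sub>x = f(t)\<close> solves both systems with the pressure \<open>- f(t) (x \<bullet> e)\<close>.  Only the boundedness of
  \<open>V\<close> is wanted, whereas \<open>f\<close> may be a distribution, so the pressure can make the layer at the boundary
  oscillate wildly in time.

  Explicitly, for a wave number \<open>l\<close> the mode
  \<open>cos (2 l\<^sup>2 t) - exp (- l x) cos (2 l\<^sup>2 t - l x)\<close> is bounded by 2, vanishes at \<open>x = 0\<close>, and has a gradient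
  of size \<open>l\<close> in the layer \<open>0 < x < 1 / l\<close>.  The \<open>p\<close>-th power of the gradient of \<open>2\<^sup>-\<^sup>k\<close> times the mode
  with wave number \<open>l\<^sub>k\<close> thus has integral of order \<open>2\<^sup>-\<^sup>k\<^sup>p l\<^sub>k\<^sup>p\<^sup>-\<^sup>1\<close>, which is unbounded once \<open>l\<^sub>k\<close> grows fast
  enough, because \<open>p > 1\<close>; the series \<open>V\<close> of these functions still converges uniformly.

  Two facts carry the proof.  First, \<open>integral_line_derivative_eq_0\<close>: a compactly supported function has
  a directional derivative with integral zero as long as there is no flux through the flat boundary.
  Applied to suitable products of a mode with a test field, it yields the weak form for each mode
  (\<open>test_field_shear_mode\<close>), and uniform convergence passes it to the series.  The pressure drops out
  because a test field, being divergence free and zero on the boundary, has mean value zero.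

  Second, the frequencies \<open>2 l\<^sub>k\<^sup>2\<close> are chosen as multiples of \<open>8 \<pi>\<close>, so that on the time interval
  \<open>(3/4, 1)\<close> of the small cylinder the modes are exactly orthogonal.  A test function that oscillates like
  the \<open>k\<close>-th mode and lives in the \<open>k\<close>-th layer therefore sees a single term of the series, and the pairing
  of its normal derivative with \<open>u\<close> equals a fixed constant times \<open>2\<^sup>-\<^sup>k\<close> (\<open>integral_layer_shear\<close>).  If
  the weak normal derivative were a function in \<open>L\<^sup>p\<close>, this pairing would be at most of the order
  \<open>M / l\<^sub>k + M\<^sup>1\<^sup>-\<^sup>p\<close> for every \<open>M > 0\<close> (\<open>norm_integral_layer_le\<close>), which contradicts the
  growth of \<open>l\<^sub>k\<close> when \<open>M\<close> is chosen well.
\<close>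

section \<open>Integrals of line derivatives over a half space\<close>

lemma dir_deriv_eqI:
  fixes f :: "'a::real_normed_vector \<Rightarrow> 'b::real_normed_vector"
  assumes "open \<Omega>" "z \<in> \<Omega>" "\<Omega> \<subseteq> S" "(f has_derivative f') (at z)"
  shows "dir_deriv S v f z = f' v"
proof -
  have "z \<in> interior S" using assms by (meson interior_maximal subsetD)
  then have "at z within S = at z" by (rule at_within_interior)
  then show ?thesis
    unfolding dir_deriv_def using frechet_derivative_at[OF assms(4)] by simp
qed

lemma has_derivative_dir_deriv:
  fixes f :: "'a::real_normed_vector \<Rightarrow> 'b::real_normed_vector"
  assumes "open \<Omega>" "z \<in> \<Omega>" "\<Omega> \<subseteq> S" "f differentiable_on S"
  shows "(f has_derivative (\<lambda>v. dir_deriv S v f z)) (at z)"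
proof -
  have "z \<in> interior S" using assms by (meson interior_maximal subsetD)
  then have eq: "at z within S = at z" by (rule at_within_interior)
  have "f differentiable (at z)"
    using assms eq by (metis differentiable_on_def subsetD)
  then show ?thesis
    unfolding dir_deriv_def eq by (simp add: frechet_derivative_works)
qed

lemma has_vector_derivative_along_line:
  fixes f :: "'a::real_normed_vector \<Rightarrow> 'b::real_normed_vector"
  assumes "(f has_derivative f') (at z)"
  shows "((\<lambda>\<tau>. f (z + \<tau> *\<^sub>R e)) has_vector_derivative f' e) (at 0)"
proof -
  have "((\<lambda>\<tau>. z + \<tau> *\<^sub>R e) has_derivative (\<lambda>\<tau>. \<tau> *\<^sub>R e)) (at 0)"
    by (auto intro!: derivative_eq_intros)
  then have "((\<lambda>\<tau>. f (z + \<tau> *\<^sub>R e)) has_derivative (\<lambda>\<tau>. f' (\<tau> *\<^sub>R e))) (at 0)"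
    using has_derivative_compose[of "\<lambda>\<tau>. z + \<tau> *\<^sub>R e" _ 0 UNIV f f'] assms by simp
  then show ?thesis
    unfolding has_vector_derivative_def
    by (simp add: linear_simps(5)[OF has_derivative_bounded_linear[OF assms]])
qed

lemma dir_deriv_eq_0_off_support:
  fixes f :: "'a::real_normed_vector \<Rightarrow> 'b::real_normed_vector"
  assumes "open \<Omega>" "\<Omega> \<subseteq> S" "closed K" "\<And>w. w \<in> \<Omega> - K \<Longrightarrow> f w = 0" "z \<in> \<Omega> - K"
  shows "dir_deriv S v f z = 0"
proof (rule dir_deriv_eqI[of "\<Omega> - K"])
  show o: "open (\<Omega> - K)" using assms by (simp add: open_Diff)
  show "(f has_derivative (\<lambda>v. 0)) (at z)"
    by (rule has_derivative_transform_within_open[OF has_derivative_const[of 0] o assms(5)])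
      (use assms(4) in auto)
qed (use assms in auto)

lemma integrable_lborel_bounded_on_ball:
  fixes f :: "'a::euclidean_space \<Rightarrow> real"
  assumes "f \<in> borel_measurable borel" "\<And>z. \<bar>f z\<bar> \<le> M" "\<And>z. R < norm z \<Longrightarrow> f z = 0"
  shows "integrable lborel f"
proof (rule Bochner_Integration.integrable_bound)
  show "integrable lborel (\<lambda>z. M * indicator (cball (0::'a) R) z)"
    using emeasure_lborel_cball_finite[of "0::'a" R]
    by (intro integrable_mult_right) (auto intro!: integrable_real_indicator)
  show "AE z in lborel. norm (f z) \<le> norm (M * indicator (cball (0::'a) R) z)"
  proof (rule AE_I2)
    fix z :: 'a
    have "0 \<le> M" using assms(2)[of z] by linarith
    then show "norm (f z) \<le> norm (M * indicator (cball (0::'a) R) z)"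
      using assms(2)[of z] assms(3)[of z] by (auto simp: indicator_def)
  qed
qed (use assms in auto)

lemma measure_lborel_Times:
  fixes A :: "'a::euclidean_space set" and B :: "'b::euclidean_space set"
  assumes "A \<in> sets borel" "B \<in> sets borel"
  shows "measure lborel (A \<times> B) = measure lborel A * measure lborel B"
  using lborel.emeasure_pair_measure_Times[of A lborel B] assms
  by (simp add: lborel_prod measure_def enn2real_mult)

lemma integrable_indicator_bounded:
  fixes A :: "'a::euclidean_space set"
  assumes "A \<in> sets borel" "bounded A"
  shows "integrable lborel (indicator A :: 'a \<Rightarrow> real)"
  using emeasure_bounded_finite[OF assms(2)] assms(1) by (intro integrable_real_indicator) auto

lemma AE_lborel_off_hyperplane:
  fixes \<nu> :: "'a::euclidean_space"
  assumes "\<nu> \<noteq> 0"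
  shows "AE z in lborel. z \<bullet> \<nu> \<noteq> 0"
proof -
  have "negligible {z. \<nu> \<bullet> z = 0}" using negligible_hyperplane assms by blast
  moreover have "{z. \<nu> \<bullet> z = 0} \<in> sets lborel" by (simp add: closed_hyperplane borel_closed)
  ultimately have "{z. \<nu> \<bullet> z = 0} \<in> null_sets lborel"
    using null_sets_completion_iff[of "{z. \<nu> \<bullet> z = 0}" lborel]
    by (simp add: negligible_iff_null_sets)
  then show ?thesis by (rule AE_I') (auto simp: inner_commute)
qed

lemma set_integrable_compact_support:
  fixes h :: "'a::euclidean_space \<Rightarrow> real"
  assumes "continuous_on S h" "compact K" "K \<subseteq> S" "open \<Omega>" "\<And>z. z \<in> \<Omega> - K \<Longrightarrow> h z = 0"
  shows "set_integrable lborel \<Omega> h"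
proof -
  have "integrable lborel (\<lambda>z. indicator K z *\<^sub>R h z)"
    by (rule borel_integrable_compact) (use assms in \<open>auto intro: continuous_on_subset\<close>)
  then have "set_integrable lborel K h" by (simp add: set_integrable_def)
  then have "set_integrable lborel (\<Omega> \<inter> K) h"
    by (rule set_integrable_subset) (use assms in \<open>auto intro: borel_open borel_compact\<close>)
  moreover have "(\<lambda>z. indicator (\<Omega> \<inter> K) z *\<^sub>R h z) = (\<lambda>z. indicator \<Omega> z *\<^sub>R h z)"
    using assms(5) by (fastforce simp: indicator_def)
  ultimately show ?thesis unfolding set_integrable_def by (simp only:)
qed

text \<open>
  Let \<open>F\<close> be \<open>f\<close> extended by zero.  By translation invariance of Lebesgue measure the difference
  quotients of \<open>F\<close> in the direction \<open>e\<close> have integral zero.  They are dominated, since \<open>F\<close> is Lipschitz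
  along \<open>e\<close>, and converge to the extension of \<open>g\<close> off the hyperplane.  Arguing by translations rather
  than by Fubini treats all directions alike, with no coordinate to be split off.  The last
  hypothesis says that nothing flows through the flat boundary: either \<open>e\<close> is tangential, or \<open>e\<close> points
  into the half space and \<open>f\<close> vanishes on the boundary, so that \<open>F\<close> has no jump along \<open>e\<close>.
\<close>

lemma integral_line_derivative_eq_0:
  fixes f g :: "'a::euclidean_space \<Rightarrow> real" and \<nu> e :: 'a and S K :: "'a set"
  defines "\<Omega> \<equiv> S \<inter> {z. 0 < z \<bullet> \<nu>}"
  assumes nu: "\<nu> \<noteq> 0" and op: "open \<Omega>" and K: "compact K"
    and supp: "\<And>z. z \<in> \<Omega> - K \<Longrightarrow> f z = 0" "\<And>z. z \<in> \<Omega> - K \<Longrightarrow> g z = 0"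
    and KS: "K \<subseteq> S"
    and cont: "continuous_on S f" "continuous_on S g"
    and deriv: "\<And>z. z \<in> \<Omega> \<Longrightarrow> ((\<lambda>\<tau>. f (z + \<tau> *\<^sub>R e)) has_real_derivative g z) (at 0)"
    and flux: "e \<bullet> \<nu> = 0 \<or> 0 < e \<bullet> \<nu> \<and> (\<forall>z\<in>S. z \<bullet> \<nu> = 0 \<longrightarrow> f z = 0)"
  shows "set_integrable lborel \<Omega> g" "(LINT z:\<Omega>|lborel. g z) = 0"
proof -
  define F where "F z = indicator \<Omega> z *\<^sub>R f z" for z
  define H where "H z = indicator \<Omega> z *\<^sub>R g z" for z
  let ?P = "{z. 0 < z \<bullet> \<nu>}"
  have \<Omega>S: "\<Omega> \<subseteq> S" unfolding \<Omega>_def by auto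
  have oP: "open ?P" using open_halfspace_gt[of 0 \<nu>] by (simp add: inner_commute)
  have closedK: "closed K" using K by (rule compact_imp_closed)
  have Foff: "z \<notin> \<Omega> \<inter> K \<Longrightarrow> F z = 0" and Hoff: "z \<notin> \<Omega> \<inter> K \<Longrightarrow> H z = 0" for z
    using supp[of z] by (auto simp: F_def H_def indicator_def)
  have Fm [measurable]: "F \<in> borel_measurable borel" and Hm [measurable]: "H \<in> borel_measurable borel"
    unfolding F_def[abs_def] H_def[abs_def]
    using borel_open[OF op] continuous_on_subset[OF _ \<Omega>S] cont
    by (blast intro: borel_measurable_continuous_on_indicator)+
  obtain M where M: "0 \<le> M" "\<And>z. \<bar>F z\<bar> \<le> M" "\<And>z. \<bar>H z\<bar> \<le> M"
  proof -
    have "bounded (f ` K)" "bounded (g ` K)"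
      using compact_imp_bounded compact_continuous_image continuous_on_subset[OF _ KS] cont K by blast+
    then obtain A B where "\<forall>z\<in>K. norm (f z) \<le> A" "\<forall>z\<in>K. norm (g z) \<le> B"
      unfolding bounded_iff by auto
    then have "\<bar>F z\<bar> \<le> max 0 (max A B)" "\<bar>H z\<bar> \<le> max 0 (max A B)" for z
      using Foff[of z] Hoff[of z] by (cases "z \<in> K"; force simp: F_def H_def indicator_def)+
    then show ?thesis using that[of "max 0 (max A B)"] by auto
  qed
  obtain R where R: "\<And>z. z \<in> K \<Longrightarrow> norm z \<le> R" using compact_imp_bounded[OF K] by (auto simp: bounded_iff)
  \<comment> \<open>Extending by zero is harmless inside the half space, because K is closed.\<close>
  have DF: "((\<lambda>\<tau>. F (z + \<tau> *\<^sub>R e)) has_real_derivative H z) (at 0)" if "z \<in> ?P" for z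
  proof -
    have tend: "((\<lambda>\<tau>::real. z + \<tau> *\<^sub>R e) \<longlongrightarrow> z) (nhds 0)"
      by (intro tendsto_eq_intros) (auto intro: filterlim_ident)
    show ?thesis
    proof (cases "z \<in> \<Omega>")
      case True
      have "\<forall>\<^sub>F \<tau> in nhds 0. z + \<tau> *\<^sub>R e \<in> \<Omega>"
        using tend op True by (rule topological_tendstoD)
      then have "\<forall>\<^sub>F \<tau> in nhds 0. F (z + \<tau> *\<^sub>R e) = f (z + \<tau> *\<^sub>R e)"
        by eventually_elim (simp add: F_def)
      moreover have "H z = g z" using True by (simp add: H_def)
      ultimately show ?thesis using deriv[OF True] by (simp add: DERIV_cong_ev)
    next
      case False
      then have "z \<in> - K" using that KS by (auto simp: \<Omega>_def)
      then have "\<forall>\<^sub>F \<tau> in nhds 0. z + \<tau> *\<^sub>R e \<in> - K"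
        using tend closedK by (intro topological_tendstoD) auto
      then have "\<forall>\<^sub>F \<tau> in nhds 0. F (z + \<tau> *\<^sub>R e) = 0"
        by eventually_elim (simp add: Foff)
      moreover have "H z = 0" using False by (simp add: H_def)
      ultimately show ?thesis by (simp add: DERIV_cong_ev)
    qed
  qed
  have DF': "((\<lambda>\<sigma>. F (z + \<sigma> *\<^sub>R e)) has_real_derivative H (z + \<tau> *\<^sub>R e)) (at \<tau>)"
    if "z + \<tau> *\<^sub>R e \<in> ?P" for z \<tau>
  proof -
    have "((\<lambda>\<sigma>. F (z + (\<tau> + \<sigma>) *\<^sub>R e)) has_real_derivative H (z + \<tau> *\<^sub>R e)) (at 0)"
      using DF[OF that] by (simp add: algebra_simps)
    then show ?thesis
      using DERIV_shift[of "\<lambda>\<sigma>. F (z + \<sigma> *\<^sub>R e)" "H (z + \<tau> *\<^sub>R e)" 0 \<tau>]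
      by (simp add: add.commute)
  qed
  have lip_inside: "\<bar>F (z + b *\<^sub>R e) - F (z + a *\<^sub>R e)\<bar> \<le> M * (b - a)"
    if "z + a *\<^sub>R e \<in> ?P" "a \<le> b" for z a b
  proof (cases "a = b")
    case False
    have inP: "z + \<tau> *\<^sub>R e \<in> ?P" if "a \<le> \<tau>" for \<tau>
    proof -
      have "a * (e \<bullet> \<nu>) \<le> \<tau> * (e \<bullet> \<nu>)" using that flux by (intro mult_right_mono) auto
      then show ?thesis using \<open>z + a *\<^sub>R e \<in> ?P\<close> by (simp add: inner_add_left)
    qed
    obtain c where "F (z + b *\<^sub>R e) - F (z + a *\<^sub>R e) = (b - a) * H (z + c *\<^sub>R e)"
      using MVT2[of a b "\<lambda>\<sigma>. F (z + \<sigma> *\<^sub>R e)" "\<lambda>\<tau>. H (z + \<tau> *\<^sub>R e)"] DF' inP \<open>a \<le> b\<close> False by force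
    then show ?thesis using M(3)[of "z + c *\<^sub>R e"] \<open>a \<le> b\<close>
      by (simp add: abs_mult mult_left_mono mult.commute[of M])
  qed simp
  \<comment> \<open>A segment that enters the half space is cut at the point where it meets the hyperplane, near which F tends to 0.\<close>
  have lip: "\<bar>F (z + s *\<^sub>R e) - F z\<bar> \<le> M * s" if "0 < s" for z s
  proof -
    consider (inside) "z \<in> ?P" | (outside) "z \<notin> ?P" "z + s *\<^sub>R e \<notin> ?P" | (cross) "z \<notin> ?P" "z + s *\<^sub>R e \<in> ?P"
      by blast
    then show ?thesis
    proof cases
      case inside
      then show ?thesis using lip_inside[of z 0 s] that by simp
    next
      case outside
      then have "F z = 0" "F (z + s *\<^sub>R e) = 0" by (simp_all add: F_def \<Omega>_def)
      then show ?thesis using M(1) that by simp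
    next
      case cross
      then have pos: "0 < e \<bullet> \<nu>" and bdry: "\<And>z. z \<in> S \<Longrightarrow> z \<bullet> \<nu> = 0 \<Longrightarrow> f z = 0"
        using flux by (auto simp: inner_add_left)
      define a where "a = - (z \<bullet> \<nu>) / (e \<bullet> \<nu>)"
      have a0: "0 \<le> a" using cross pos by (simp add: a_def divide_nonpos_pos)
      have az: "(z + a *\<^sub>R e) \<bullet> \<nu> = 0"
        using pos by (simp add: a_def inner_add_left inner_diff_left)
      have "z \<bullet> \<nu> + a * (e \<bullet> \<nu>) < z \<bullet> \<nu> + s * (e \<bullet> \<nu>)"
        using cross az by (simp add: inner_add_left)
      then have as: "a < s" using pos by simp
      have tend: "((\<lambda>\<tau>. z + \<tau> *\<^sub>R e) \<longlongrightarrow> z + a *\<^sub>R e) (at_right a)"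
        by (intro tendsto_intros)
      have lim: "((\<lambda>\<tau>. F (z + \<tau> *\<^sub>R e)) \<longlongrightarrow> 0) (at_right a)"
      proof (cases "z + a *\<^sub>R e \<in> S")
        case True
        show ?thesis
        proof (rule tendstoI)
          fix \<epsilon> :: real assume "0 < \<epsilon>"
          moreover have "f (z + a *\<^sub>R e) = 0" using bdry True az by blast
          ultimately obtain d where d: "0 < d" "\<And>w. w \<in> S \<Longrightarrow> dist w (z + a *\<^sub>R e) < d \<Longrightarrow> \<bar>f w\<bar> < \<epsilon>"
            using cont(1) True unfolding continuous_on_iff by (fastforce simp: dist_real_def)
          have "\<forall>\<^sub>F \<tau> in at_right a. dist (z + \<tau> *\<^sub>R e) (z + a *\<^sub>R e) < d"
            using tend d(1) by (rule tendstoD)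
          then show "\<forall>\<^sub>F \<tau> in at_right a. dist (F (z + \<tau> *\<^sub>R e)) 0 < \<epsilon>"
            by eventually_elim (use d(2) \<open>0 < \<epsilon>\<close> \<Omega>S in \<open>auto simp: F_def indicator_def\<close>)
        qed
      next
        case False
        then have "z + a *\<^sub>R e \<in> - K" using KS by auto
        then have "\<forall>\<^sub>F \<tau> in at_right a. z + \<tau> *\<^sub>R e \<in> - K"
          using tend closedK by (intro topological_tendstoD) auto
        then have "\<forall>\<^sub>F \<tau> in at_right a. F (z + \<tau> *\<^sub>R e) = 0"
          by eventually_elim (simp add: Foff)
        then show ?thesis by (rule tendsto_eventually)
      qed
      have "((\<lambda>\<tau>. \<bar>F (z + s *\<^sub>R e) - F (z + \<tau> *\<^sub>R e)\<bar>) \<longlongrightarrow> \<bar>F (z + s *\<^sub>R e) - 0\<bar>) (at_right a)"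
        by (intro tendsto_intros lim)
      moreover have "\<forall>\<^sub>F \<tau> in at_right a. \<bar>F (z + s *\<^sub>R e) - F (z + \<tau> *\<^sub>R e)\<bar> \<le> M * s"
        using eventually_at_right_less eventually_at_right_real[OF as]
      proof eventually_elim
        case (elim \<tau>)
        have "a * (e \<bullet> \<nu>) < \<tau> * (e \<bullet> \<nu>)" using elim pos by simp
        then have "z + \<tau> *\<^sub>R e \<in> ?P" using az by (simp add: inner_add_left)
        then have "\<bar>F (z + s *\<^sub>R e) - F (z + \<tau> *\<^sub>R e)\<bar> \<le> M * (s - \<tau>)"
          using elim by (intro lip_inside) auto
        also have "\<dots> \<le> M * s" using M(1) a0 elim by (intro mult_left_mono) auto
        finally show ?case .
      qed
      ultimately have "\<bar>F (z + s *\<^sub>R e) - 0\<bar> \<le> M * s"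
        by (rule tendsto_upperbound) (simp add: trivial_limit_at_right_real)
      moreover have "F z = 0" using cross by (simp add: F_def \<Omega>_def)
      ultimately show ?thesis by simp
    qed
  qed
  have Foff': "F z = 0" "H z = 0" if "R < norm z" for z
    using R[of z] that Foff[of z] Hoff[of z] by auto
  have Fint: "integrable lborel F"
    by (rule integrable_lborel_bounded_on_ball[OF Fm M(2), of R]) (use Foff' in auto)
  have Hint: "integrable lborel H"
    by (rule integrable_lborel_bounded_on_ball[OF Hm M(3), of R]) (use Foff' in auto)
  show "set_integrable lborel \<Omega> g"
    using Hint by (simp add: set_integrable_def H_def[abs_def])
  \<comment> \<open>Positive step sizes: translations along e then never leave the half space.\<close>
  define s where "s n = inverse (real (Suc n))" for n
  have s: "0 < s n" "s n \<le> 1" for n by (auto simp: s_def inverse_eq_divide divide_simps)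
  have s0: "s \<longlonglongrightarrow> 0" unfolding s_def by (rule LIMSEQ_inverse_real_of_nat)
  define D where "D n z = (F (z + s n *\<^sub>R e) - F z) / s n" for n z
  have Dm [measurable]: "D n \<in> borel_measurable borel" for n
    unfolding D_def[abs_def] by measurable
  have "(\<lambda>n. \<integral>z. D n z \<partial>lborel) \<longlonglongrightarrow> (\<integral>z. H z \<partial>lborel)"
  proof (rule integral_dominated_convergence)
    show "integrable lborel (\<lambda>z. M * indicator (cball (0::'a) (R + norm e)) z)"
      using emeasure_lborel_cball_finite[of "0::'a" "R + norm e"]
      by (intro integrable_mult_right) (auto intro!: integrable_real_indicator)
    show "AE z in lborel. norm (D n z) \<le> M * indicator (cball (0::'a) (R + norm e)) z" for n
    proof (rule AE_I2)
      fix z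
      show "norm (D n z) \<le> M * indicator (cball (0::'a) (R + norm e)) z"
      proof (cases "z \<in> cball 0 (R + norm e)")
        case True
        then show ?thesis using lip[OF s(1), of z n] s(1)[of n] by (simp add: D_def divide_simps)
      next
        case False
        have "norm z \<le> norm (z + s n *\<^sub>R e) + norm (s n *\<^sub>R e)"
          by (metis add_diff_cancel_right' norm_triangle_ineq4)
        moreover have "norm (s n *\<^sub>R e) \<le> norm e" using s[of n] by (simp add: mult_left_le_one_le)
        ultimately have "R < norm (z + s n *\<^sub>R e)" "R < norm z"
          using False norm_ge_zero[of e] by (auto simp del: norm_ge_zero)
        then show ?thesis using M(1) by (simp add: D_def Foff')
      qed
    qed
    show "AE z in lborel. (\<lambda>n. D n z) \<longlonglongrightarrow> H z"
      using AE_lborel_off_hyperplane[OF nu]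
    proof eventually_elim
      case (elim z)
      show ?case
      proof (cases "z \<in> ?P")
        case True
        have "((\<lambda>h. (F (z + h *\<^sub>R e) - F z) / h) \<longlongrightarrow> H z) (at 0)"
          using DF[OF True] by (simp add: DERIV_def)
        moreover have "filterlim s (at 0) sequentially"
          using s0 s(1)[THEN less_imp_neq[THEN not_sym]] by (simp add: filterlim_at)
        ultimately show ?thesis unfolding D_def by (rule filterlim_compose)
      next
        case False
        then have "z \<in> {z. z \<bullet> \<nu> < 0}" using elim by auto
        moreover have "open {z. z \<bullet> \<nu> < 0}" using open_halfspace_lt[of \<nu> 0] by (simp add: inner_commute)
        moreover have "(\<lambda>n. z + s n *\<^sub>R e) \<longlonglongrightarrow> z"
          by (rule tendsto_eq_intros s0 refl)+ simp
        ultimately have "\<forall>\<^sub>F n in sequentially. z + s n *\<^sub>R e \<in> {z. z \<bullet> \<nu> < 0}"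
          using topological_tendstoD by blast
        then have "\<forall>\<^sub>F n in sequentially. D n z = H z"
          by eventually_elim (use False in \<open>auto simp: D_def F_def H_def \<Omega>_def\<close>)
        then show ?thesis by (rule tendsto_eventually)
      qed
    qed
  qed auto
  moreover have "(\<integral>z. D n z \<partial>lborel) = 0" for n
  proof -
    have tr: "distr lborel borel ((+) (s n *\<^sub>R e)) = (lborel :: 'a measure)" by (rule lborel_distr_plus)
    have i1: "integrable lborel (\<lambda>z. F (s n *\<^sub>R e + z))"
      using integrable_distr[of "(+) (s n *\<^sub>R e)" lborel borel F] tr Fint by simp
    have "(\<integral>z. F (s n *\<^sub>R e + z) \<partial>lborel) = (\<integral>z. F z \<partial>lborel)"
      using integral_distr[of "(+) (s n *\<^sub>R e)" lborel borel F] tr by simp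
    then show ?thesis unfolding D_def using Fint i1
      by (simp add: add.commute)
  qed
  ultimately have "(\<integral>z. H z \<partial>lborel) = 0" by (simp add: LIMSEQ_const_iff)
  then show "(LINT z:\<Omega>|lborel. g z) = 0"
    by (simp add: set_lebesgue_integral_def H_def[abs_def])
qed

section \<open>Smooth functions\<close>

lemma Ck_on_cong:
  assumes "Ck_on k S f" "\<And>z. z \<in> S \<Longrightarrow> f z = g z"
  shows "Ck_on k S g"
  using assms
proof (induction k arbitrary: f g)
  case 0
  then show ?case by (metis (mono_tags) Ck_on.simps(1) continuous_on_cong)
next
  case (Suc k)
  have hd: "(f has_derivative f') (at z within S) \<longleftrightarrow> (g has_derivative f') (at z within S)"
    if "z \<in> S" for z f'
    using that Suc.prems(2) has_derivative_transform[of z S] by metis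
  have "dir_deriv S v f z = dir_deriv S v g z" if "z \<in> S" for v z
    using hd[OF that] by (simp add: dir_deriv_def frechet_derivative_def)
  moreover have "g differentiable_on S"
    using Suc.prems hd by (auto simp: differentiable_on_def differentiable_def)
  ultimately show ?case using Suc.IH Suc.prems(1) by (metis Ck_on.simps(2))
qed

lemma Ck_on_Suc_imp: "Ck_on (Suc k) S f \<Longrightarrow> Ck_on k S f"
proof (induction k arbitrary: f)
  case 0 then show ?case by (simp add: differentiable_imp_continuous_on)
next
  case (Suc k)
  then show ?case by (metis Ck_on.simps(2))
qed

text \<open>
  On an open set derivatives within the set are ordinary derivatives, so a rule with explicitly given
  derivatives is available; all closure properties below follow from it by induction on the order.
\<close>

lemma Ck_on_SucI:
  fixes f :: "'a::real_normed_vector \<Rightarrow> 'b::real_normed_vector"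
  assumes "open S" "\<And>z. z \<in> S \<Longrightarrow> (f has_derivative f' z) (at z)"
    and "\<And>v. Ck_on k S (\<lambda>z. f' z v)"
  shows "Ck_on (Suc k) S f"
proof -
  have "dir_deriv S v f z = f' z v" if "z \<in> S" for v z
    using dir_deriv_eqI[OF assms(1) that order.refl] assms(2) that by blast
  then have "Ck_on k S (dir_deriv S v f)" for v
    using Ck_on_cong[OF assms(3)] by simp
  moreover have "f differentiable_on S"
    using assms(2) by (meson differentiable_at_withinI differentiable_def differentiable_on_def)
  ultimately show ?thesis by simp
qed

lemma Ck_on_const: "open S \<Longrightarrow> Ck_on k S (\<lambda>z. c)"
proof (induction k arbitrary: c)
  case (Suc k) then show ?case by (intro Ck_on_SucI[of _ _ "\<lambda>_ _. 0"]) auto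
qed simp

lemma Ck_on_bounded_linear:
  assumes "open S" "bounded_linear f"
  shows "Ck_on k S f"
proof (cases k)
  case 0 then show ?thesis using assms by (simp add: linear_continuous_on)
next
  case (Suc l)
  then show ?thesis using assms
    by (auto intro!: Ck_on_SucI[of _ _ "\<lambda>_. f"] bounded_linear_imp_has_derivative Ck_on_const
        simp del: Ck_on.simps)
qed

lemma Ck_on_add:
  fixes f g :: "'a::real_normed_vector \<Rightarrow> 'b::real_normed_vector"
  assumes "open S" "Ck_on k S f" "Ck_on k S g"
  shows "Ck_on k S (\<lambda>z. f z + g z)"
  using assms(2,3)
proof (induction k arbitrary: f g)
  case 0 then show ?case by (simp add: continuous_on_add)
next
  case (Suc k)
  then show ?case
    by (intro Ck_on_SucI[OF assms(1), of _ "\<lambda>z v. dir_deriv S v f z + dir_deriv S v g z"]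
        has_derivative_add has_derivative_dir_deriv[OF assms(1) _ order.refl]) auto
qed

lemma Ck_on_mult:
  fixes f g :: "'a::real_normed_vector \<Rightarrow> real"
  assumes "open S" "Ck_on k S f" "Ck_on k S g"
  shows "Ck_on k S (\<lambda>z. f z * g z)"
  using assms(2,3)
proof (induction k arbitrary: f g)
  case 0 then show ?case by (simp add: continuous_on_mult)
next
  case (Suc k)
  show ?case
  proof (rule Ck_on_SucI[OF assms(1), of _ "\<lambda>z v. f z * dir_deriv S v g z + dir_deriv S v f z * g z"])
    fix z assume "z \<in> S"
    then show "((\<lambda>z. f z * g z) has_derivative
        (\<lambda>v. f z * dir_deriv S v g z + dir_deriv S v f z * g z)) (at z)"
      using Suc.prems
      by (intro has_derivative_mult has_derivative_dir_deriv[OF assms(1) _ order.refl]) auto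
  next
    fix v
    show "Ck_on k S (\<lambda>z. f z * dir_deriv S v g z + dir_deriv S v f z * g z)"
      using Suc.prems Suc.prems[THEN Ck_on_Suc_imp]
      by (intro Ck_on_add[OF assms(1)] Suc.IH) auto
  qed
qed

lemma Ck_on_affine:
  fixes f :: "'a::real_normed_vector \<Rightarrow> real"
  assumes "open S" "bounded_linear f"
  shows "Ck_on k S (\<lambda>z. c + d * f z)"
  by (intro Ck_on_add Ck_on_mult Ck_on_const Ck_on_bounded_linear assms)

text \<open>
  Taking a whole sequence of iterated derivatives \<open>D n\<close> as hypothesis lets the induction run over all of
  them at once: a derivative of \<open>D n \<circ> f\<close> is \<open>D (Suc n) \<circ> f\<close> times a derivative of \<open>f\<close>.
\<close>

lemma Ck_on_compose:
  fixes D :: "nat \<Rightarrow> real \<Rightarrow> real" and f :: "'a::real_normed_vector \<Rightarrow> real"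
  assumes "open S" and D: "\<And>n y. (D n has_real_derivative D (Suc n) y) (at y)"
    and "Ck_on k S f"
  shows "Ck_on k S (\<lambda>z. D n (f z))"
  using assms(3)
proof (induction k arbitrary: n)
  case 0
  have "continuous_on UNIV (D n)" using D DERIV_isCont continuous_at_imp_continuous_on by blast
  with 0 show ?case using continuous_on_compose2[of UNIV "D n" S f] by simp
next
  case (Suc k)
  show ?case
  proof (rule Ck_on_SucI[OF assms(1), of _ "\<lambda>z v. D (Suc n) (f z) * dir_deriv S v f z"])
    fix z assume "z \<in> S"
    then have "(f has_derivative (\<lambda>v. dir_deriv S v f z)) (at z)"
      using Suc.prems by (intro has_derivative_dir_deriv[OF assms(1) _ order.refl]) auto
    moreover have "(D n has_derivative (\<lambda>y. D (Suc n) (f z) * y)) (at (f z))"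
      using D by (simp add: has_field_derivative_def)
    ultimately show "((\<lambda>z. D n (f z)) has_derivative (\<lambda>v. D (Suc n) (f z) * dir_deriv S v f z)) (at z)"
      by (rule has_derivative_compose)
  next
    fix v
    show "Ck_on k S (\<lambda>z. D (Suc n) (f z) * dir_deriv S v f z)"
      using Suc.prems Suc.prems[THEN Ck_on_Suc_imp]
      by (intro Ck_on_mult[OF assms(1)] Suc.IH) auto
  qed
qed

text \<open>
  For \<open>y > 0\<close> each derivative of \<open>exp (- 1 / y)\<close> has the form \<open>P(1 / y) exp (- 1 / y)\<close> with a polynomial \<open>P\<close>,
  and differentiation replaces \<open>P(X)\<close> by \<open>X\<^sup>2 (P(X) - P'(X))\<close>.
\<close>

primrec bump_poly :: "nat \<Rightarrow> real poly" where
  "bump_poly 0 = 1"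
| "bump_poly (Suc n) = [:0, 0, 1:] * (bump_poly n - pderiv (bump_poly n))"

definition bump_deriv :: "nat \<Rightarrow> real \<Rightarrow> real" where
  "bump_deriv n y = (if 0 < y then poly (bump_poly n) (1 / y) * exp (- (1 / y)) else 0)"

abbreviation bump :: "real \<Rightarrow> real" where "bump \<equiv> bump_deriv 0"

lemma bump_eq: "bump y = (if 0 < y then exp (- (1 / y)) else 0)"
  by (simp add: bump_deriv_def)

lemma tendsto_poly_times_exp_uminus: "((\<lambda>x. poly q x * exp (- x)) \<longlongrightarrow> (0::real)) at_top"
proof -
  have "((\<lambda>x. \<Sum>i\<le>degree q. coeff q i * (x ^ i / exp x)) \<longlongrightarrow> (\<Sum>i\<le>degree q. coeff q i * 0)) at_top"
    by (intro tendsto_sum tendsto_mult tendsto_const tendsto_power_div_exp_0)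
  then show ?thesis
    by (simp add: poly_altdef sum_distrib_right exp_minus divide_inverse mult.assoc)
qed

text \<open>
  Only \<open>y = 0\<close> needs an argument: there the difference quotient from the right is a polynomial in
  \<open>1 / h\<close> times \<open>exp (- 1 / h)\<close>, and the exponential wins.
\<close>

lemma has_real_derivative_bump_deriv:
  "(bump_deriv n has_real_derivative bump_deriv (Suc n) y) (at y)"
proof -
  consider (pos) "0 < y" | (neg) "y < 0" | (zero) "y = 0" by linarith
  then show ?thesis
  proof cases
    case pos
    let ?p = "bump_poly n"
    have inv: "((\<lambda>y. 1 / y) has_real_derivative - (1 / y\<^sup>2)) (at y)"
      using pos by (auto intro!: derivative_eq_intros simp: power2_eq_square)
    have "((\<lambda>y. poly ?p (1 / y) * exp (- (1 / y))) has_real_derivative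
        poly (pderiv ?p) (1 / y) * - (1 / y\<^sup>2) * exp (- (1 / y))
        + exp (- (1 / y)) * - (- (1 / y\<^sup>2)) * poly ?p (1 / y)) (at y)"
      by (intro DERIV_mult DERIV_chain2[OF poly_DERIV inv] DERIV_chain2[OF DERIV_exp DERIV_minus[OF inv]])
    moreover have "poly (pderiv ?p) (1 / y) * - (1 / y\<^sup>2) * exp (- (1 / y))
        + exp (- (1 / y)) * - (- (1 / y\<^sup>2)) * poly ?p (1 / y) = bump_deriv (Suc n) y"
      using pos by (simp add: bump_deriv_def algebra_simps power2_eq_square)
    moreover have "\<forall>\<^sub>F y in nhds y. y \<in> {0<..}"
      by (rule eventually_nhds_in_open) (use pos in auto)
    then have ev: "\<forall>\<^sub>F y in nhds y. bump_deriv n y = poly ?p (1 / y) * exp (- (1 / y))"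
      by eventually_elim (simp add: bump_deriv_def)
    ultimately show ?thesis using DERIV_cong_ev[OF refl ev refl] by metis
  next
    case neg
    have "\<forall>\<^sub>F y in nhds y. y \<in> {..<0}"
      by (rule eventually_nhds_in_open) (use neg in auto)
    then have ev: "\<forall>\<^sub>F y in nhds y. bump_deriv n y = 0"
      by eventually_elim (simp add: bump_deriv_def)
    have "bump_deriv (Suc n) y = 0" using neg by (simp add: bump_deriv_def)
    then show ?thesis using DERIV_cong_ev[OF refl ev refl] DERIV_const by metis
  next
    case zero
    let ?q = "[:0, 1:] * bump_poly n"
    have "((\<lambda>h. poly ?q (inverse h) * exp (- inverse h)) \<longlongrightarrow> 0) (at_right (0::real))"
      by (rule filterlim_compose[OF tendsto_poly_times_exp_uminus filterlim_inverse_at_top_right])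
    moreover have "\<forall>\<^sub>F h in at_right (0::real). poly ?q (inverse h) * exp (- inverse h) = bump_deriv n h / h"
      using eventually_at_right_less[of "0::real"]
      by eventually_elim (simp add: bump_deriv_def field_simps)
    ultimately have "((\<lambda>h. bump_deriv n h / h) \<longlongrightarrow> 0) (at_right 0)"
      by (rule Lim_transform_eventually)
    moreover have "((\<lambda>h. bump_deriv n h / h) \<longlongrightarrow> 0) (at_left 0)"
      by (rule tendsto_eventually, rule eventually_mono[OF eventually_at_left_real[of "-1"]])
        (simp_all add: bump_deriv_def)
    ultimately have "((\<lambda>h. bump_deriv n h / h) \<longlongrightarrow> 0) (at 0)"
      by (simp add: filterlim_split_at)
    moreover have "bump_deriv k 0 = 0" for k by (simp add: bump_deriv_def)
    ultimately show ?thesis using zero by (simp add: DERIV_def)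
  qed
qed

lemma bump_nonneg: "0 \<le> bump y" and bump_le_1: "bump y \<le> 1"
  and bump_pos: "0 < y \<Longrightarrow> 0 < bump y" and bump_eq_0: "y \<le> 0 \<Longrightarrow> bump y = 0"
  by (auto simp: bump_eq)

lemma bump_mono: "x \<le> y \<Longrightarrow> bump x \<le> bump y"
  by (auto simp: bump_eq divide_left_mono frac_le)

lemma continuous_on_bump_deriv [continuous_intros]:
  "continuous_on S f \<Longrightarrow> continuous_on S (\<lambda>z. bump_deriv n (f z))"
  using has_real_derivative_bump_deriv DERIV_isCont continuous_at_imp_continuous_on
  by (metis UNIV_I continuous_on_compose2 subsetI)

lemma bump_tendsto_1: "(bump \<longlongrightarrow> 1) at_top"
proof -
  have "((\<lambda>y::real. exp (- (inverse y))) \<longlongrightarrow> exp (- 0)) at_top"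
    by (intro tendsto_intros tendsto_inverse_0_at_top filterlim_ident)
  moreover have "\<forall>\<^sub>F y in at_top. exp (- (inverse y)) = bump y"
    using eventually_gt_at_top[of "0::real"] by eventually_elim (simp add: bump_eq inverse_eq_divide)
  ultimately show ?thesis by (auto dest: Lim_transform_eventually)
qed

primrec cos_deriv :: "nat \<Rightarrow> real \<Rightarrow> real" where
  "cos_deriv 0 = cos"
| "cos_deriv (Suc n) = (\<lambda>y. cos_deriv n (y + pi / 2))"

lemma has_real_derivative_cos_deriv:
  "(cos_deriv n has_real_derivative cos_deriv (Suc n) y) (at y)"
proof (induction n arbitrary: y)
  case 0
  show ?case by (auto intro!: derivative_eq_intros simp: cos_add)
next
  case (Suc n)
  show ?case using DERIV_shift[of "cos_deriv n" _ y "pi / 2"] Suc[of "y + pi / 2"]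
    by (simp add: add.commute)
qed

lemma Ck_on_bump: "open S \<Longrightarrow> Ck_on k S f \<Longrightarrow> Ck_on k S (\<lambda>z. bump (f z))"
  by (rule Ck_on_compose[where D = bump_deriv, OF _ has_real_derivative_bump_deriv])

lemma Ck_on_cos:
  fixes f :: "'a::real_normed_vector \<Rightarrow> real"
  shows "open S \<Longrightarrow> Ck_on k S f \<Longrightarrow> Ck_on k S (\<lambda>z. cos (f z))"
  using Ck_on_compose[where D = cos_deriv, OF _ has_real_derivative_cos_deriv, of S k f 0] by simp

lemma Ck_on_inner_linear:
  fixes f :: "'a::real_normed_vector \<Rightarrow> 'b::real_inner"
  assumes "open S" "bounded_linear f"
  shows "Ck_on k S (\<lambda>z. f z \<bullet> f z)"
proof (cases k)
  case 0 then show ?thesis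
    using linear_continuous_on[OF assms(2)] by (simp add: continuous_on_inner)
next
  case (Suc l)
  show ?thesis unfolding Suc
  proof (rule Ck_on_SucI[OF assms(1), of _ "\<lambda>z v. f z \<bullet> f v + f v \<bullet> f z"])
    show "((\<lambda>z. f z \<bullet> f z) has_derivative (\<lambda>v. f z \<bullet> f v + f v \<bullet> f z)) (at z)" for z
      by (intro has_derivative_inner bounded_linear_imp_has_derivative assms)
    show "Ck_on l S (\<lambda>z. f z \<bullet> f v + f v \<bullet> f z)" for v
      by (intro Ck_on_bounded_linear assms bounded_linear_add
          bounded_linear_compose[OF bounded_linear_inner_left assms(2)]
          bounded_linear_compose[OF bounded_linear_inner_right assms(2)])
  qed
qed

section \<open>Oscillating shear modes\<close>

text \<open>
  The boundary layer of a fluid that oscillates with frequency \<open>2 l\<^sup>2\<close> along a resting wall (Stokes' second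
  problem): the second term is the bounded solution of the heat equation on the half line that agrees with
  the first term at the wall.  The three functions after it are its partial derivatives.
\<close>

definition shear_mode :: "real \<Rightarrow> real \<Rightarrow> real \<Rightarrow> real" where
  "shear_mode l x t = cos (2 * l\<^sup>2 * t) - exp (- (l * x)) * cos (2 * l\<^sup>2 * t - l * x)"

definition shear_mode_x :: "real \<Rightarrow> real \<Rightarrow> real \<Rightarrow> real" where
  "shear_mode_x l x t = l * exp (- (l * x)) * (cos (2 * l\<^sup>2 * t - l * x) - sin (2 * l\<^sup>2 * t - l * x))"

definition shear_mode_xx :: "real \<Rightarrow> real \<Rightarrow> real \<Rightarrow> real" where
  "shear_mode_xx l x t = 2 * l\<^sup>2 * exp (- (l * x)) * sin (2 * l\<^sup>2 * t - l * x)"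

definition shear_mode_t :: "real \<Rightarrow> real \<Rightarrow> real \<Rightarrow> real" where
  "shear_mode_t l x t = 2 * l\<^sup>2 * exp (- (l * x)) * sin (2 * l\<^sup>2 * t - l * x) - 2 * l\<^sup>2 * sin (2 * l\<^sup>2 * t)"

text \<open>
  Derivatives are stated along lines because the integration by parts below consumes them in this form.
\<close>

lemma shear_mode_line_derivative:
  "((\<lambda>\<tau>. shear_mode l (x + \<tau> * a) (t + \<tau> * b)) has_real_derivative
     a * shear_mode_x l x t + b * shear_mode_t l x t) (at 0)"
  unfolding shear_mode_def shear_mode_x_def shear_mode_t_def
  by (auto intro!: derivative_eq_intros simp: algebra_simps)

lemma shear_mode_x_line_derivative:
  "((\<lambda>\<tau>. shear_mode_x l (x + \<tau> * a) t) has_real_derivative a * shear_mode_xx l x t) (at 0)"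
  unfolding shear_mode_x_def shear_mode_xx_def
  by (auto intro!: derivative_eq_intros simp: algebra_simps power2_eq_square)

text \<open>
  The mode solves the heat equation up to a force that depends on time only; such a force is the
  gradient of a pressure that is linear in the space variable.
\<close>

lemma shear_mode_heat:
  "shear_mode_xx l x t - shear_mode_t l x t = 2 * l\<^sup>2 * sin (2 * l\<^sup>2 * t)"
  by (simp add: shear_mode_xx_def shear_mode_t_def)

lemma shear_mode_0 [simp]: "shear_mode l 0 t = 0"
  by (simp add: shear_mode_def)

lemma continuous_on_shear_mode [continuous_intros]:
  fixes f g :: "'a::t2_space \<Rightarrow> real"
  assumes "continuous_on S f" "continuous_on S g"
  shows "continuous_on S (\<lambda>z. shear_mode l (f z) (g z))"
    "continuous_on S (\<lambda>z. shear_mode_x l (f z) (g z))"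
    "continuous_on S (\<lambda>z. shear_mode_xx l (f z) (g z))"
    "continuous_on S (\<lambda>z. shear_mode_t l (f z) (g z))"
  unfolding shear_mode_def shear_mode_x_def shear_mode_xx_def shear_mode_t_def
  by (intro continuous_intros assms)+

lemma abs_shear_mode_le:
  assumes "0 \<le> l" "0 \<le> x"
  shows "\<bar>shear_mode l x t\<bar> \<le> 2"
proof -
  have "\<bar>exp (- (l * x)) * cos (2 * l\<^sup>2 * t - l * x)\<bar> \<le> 1 * 1"
    unfolding abs_mult using assms by (intro mult_mono) (auto intro: abs_cos_le_one)
  moreover have "\<bar>cos (2 * l\<^sup>2 * t)\<bar> \<le> 1" by (rule abs_cos_le_one)
  ultimately show ?thesis unfolding shear_mode_def by linarith
qed

text \<open>
  The weights make the series converge uniformly on \<open>x \<ge> 0\<close>; below the wall the terms grow exponentially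
  and \<open>suminf\<close> returns an arbitrary value.
\<close>

definition shear :: "(nat \<Rightarrow> real) \<Rightarrow> real \<Rightarrow> real \<Rightarrow> real" where
  "shear \<kappa> x t = (\<Sum>k. (1/2) ^ k * shear_mode (\<kappa> k) x t)"

lemma shear_term_le:
  assumes "\<And>k. 0 \<le> \<kappa> k" "0 \<le> x"
  shows "\<bar>(1/2) ^ k * shear_mode (\<kappa> k) x t\<bar> \<le> (1/2) ^ k * 2"
  unfolding abs_mult using abs_shear_mode_le[OF assms(1)[of k] assms(2), of t]
  by (intro mult_mono) auto

lemma summable_half_powers: "summable (\<lambda>k. (1/2::real) ^ k * c)"
  by (intro summable_mult2 summable_geometric) simp

lemma summable_shear:
  assumes "\<And>k. 0 \<le> \<kappa> k" "0 \<le> x"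
  shows "summable (\<lambda>k. \<bar>(1/2) ^ k * shear_mode (\<kappa> k) x t\<bar>)"
  by (rule summable_comparison_test'[OF summable_half_powers[of 2], of 0])
    (use shear_term_le[where \<kappa> = \<kappa>, OF assms] in auto)

lemma abs_shear_le:
  assumes "\<And>k. 0 \<le> \<kappa> k" "0 \<le> x"
  shows "\<bar>shear \<kappa> x t\<bar> \<le> 4"
proof -
  have "\<bar>shear \<kappa> x t\<bar> \<le> (\<Sum>k. \<bar>(1/2) ^ k * shear_mode (\<kappa> k) x t\<bar>)"
    unfolding shear_def by (rule summable_rabs[OF summable_shear[where \<kappa> = \<kappa>, OF assms]])
  also have "\<dots> \<le> (\<Sum>k. (1/2) ^ k * 2)"
    by (intro suminf_le summable_shear summable_half_powers shear_term_le assms)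
  also have "\<dots> = 4"
    using suminf_mult2[of "\<lambda>k. (1/2::real) ^ k" 2] by (simp add: suminf_geometric summable_geometric)
  finally show ?thesis .
qed

lemma continuous_on_shear:
  fixes f g :: "'a::t2_space \<Rightarrow> real"
  assumes "\<And>k. 0 \<le> \<kappa> k" "continuous_on S f" "continuous_on S g" "\<And>z. z \<in> S \<Longrightarrow> 0 \<le> f z"
  shows "continuous_on S (\<lambda>z. shear \<kappa> (f z) (g z))"
proof (rule uniform_limit_theorem)
  show "\<forall>\<^sub>F n in sequentially. continuous_on S (\<lambda>z. \<Sum>k<n. (1/2) ^ k * shear_mode (\<kappa> k) (f z) (g z))"
    by (intro always_eventually allI continuous_intros assms)
  show "uniform_limit S (\<lambda>n z. \<Sum>k<n. (1/2) ^ k * shear_mode (\<kappa> k) (f z) (g z))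
      (\<lambda>z. shear \<kappa> (f z) (g z)) sequentially"
    unfolding shear_def
    by (rule Weierstrass_m_test[OF _ summable_half_powers[of 2]])
      (use shear_term_le[where \<kappa> = \<kappa>, OF assms(1) assms(4)] in auto)
qed simp

section \<open>Shear flows as very weak solutions\<close>

abbreviation open_cyl :: "(('m::finite) pt \<times> real) set" where
  "open_cyl \<equiv> half_ball 2 \<times> {0<..<4}"

lemma open_half_ball: "open (half_ball r)"
  unfolding half_ball_def by (intro open_Collect_conj open_Collect_less continuous_intros)

lemma open_open_cyl: "open open_cyl"
  by (intro open_Times open_half_ball open_greaterThanLessThan)

lemma dom_D_eq: "dom_D = {x. norm x < 2 \<and> 0 \<le> snd x}"
  unfolding dom_D_def half_ball_def by auto

lemma half_ball_eq: "half_ball 2 = dom_D \<inter> {x. 0 < x \<bullet> (0, 1)}"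
  unfolding dom_D_eq half_ball_def by (auto simp: inner_prod_def)

lemma open_cyl_eq: "open_cyl = dom_DT \<inter> {z. 0 < z \<bullet> ((0, 1), 0)}"
  unfolding dom_DT_def dom_D_eq half_ball_def by (auto simp: inner_prod_def)

lemma dom_DT_snd_fst: "z \<in> dom_DT \<Longrightarrow> 0 \<le> snd (fst z)"
  by (auto simp: dom_DT_def dom_D_eq)

lemma open_cyl_subset: "open_cyl \<subseteq> dom_DT" unfolding open_cyl_eq by blast

lemma Basis_pt_cases:
  assumes "(b :: ('m::finite) pt) \<in> Basis"
  shows "snd b = 0 \<or> b = (0, 1)"
  using assms by (auto simp: Basis_prod_def)

lemma snd_Basis_pt: "(b :: ('m::finite) pt) \<in> Basis \<Longrightarrow> snd b = (if b = (0, 1) then 1 else 0)"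
  using Basis_pt_cases[of b] by auto

lemma normal_in_Basis: "((0, 1) :: ('m::finite) pt) \<in> Basis"
  by (auto simp: Basis_prod_def)

lemma sum_Basis_snd: "(\<Sum>b\<in>(Basis :: ('m::finite) pt set). snd b * c) = c"
proof -
  have "(\<Sum>b\<in>(Basis :: 'm pt set). snd b * c) = (\<Sum>b\<in>(Basis :: 'm pt set). if b = (0, 1) then c else 0)"
    by (intro sum.cong) (auto simp: snd_Basis_pt)
  also have "\<dots> = c" by (simp add: normal_in_Basis)
  finally show ?thesis .
qed

lemma set_integral_zero_sum:
  fixes f :: "'i \<Rightarrow> 'a \<Rightarrow> real"
  assumes "finite I" "\<And>i. i \<in> I \<Longrightarrow> set_integrable M A (f i)" "\<And>i. i \<in> I \<Longrightarrow> (LINT x:A|M. f i x) = 0"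
  shows "set_integrable M A (\<lambda>x. \<Sum>i\<in>I. f i x)" "(LINT x:A|M. (\<Sum>i\<in>I. f i x)) = 0"
proof -
  have "set_integrable M A (\<lambda>x. \<Sum>i\<in>I. f i x) \<and> (LINT x:A|M. (\<Sum>i\<in>I. f i x)) = 0"
    using assms by (induction rule: finite_induct) (auto simp: set_integrable_def set_lebesgue_integral_def
      algebra_simps simp flip: sum_distrib_left)
  then show "set_integrable M A (\<lambda>x. \<Sum>i\<in>I. f i x)" "(LINT x:A|M. (\<Sum>i\<in>I. f i x)) = 0" by auto
qed

text \<open>
  The weak formulation integrates in space first and in time second, with respect to the completed
  measures.  For the integrands below this is a single Borel integral over the space-time cylinder.
\<close>

lemma iterated_integral_open_cyl:
  fixes h :: "('m::finite) pt \<times> real \<Rightarrow> real"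
  assumes "set_integrable lborel open_cyl h"
  shows "(LINT t:{0<..<4}|lebesgue. LINT x:half_ball 2|lebesgue. h (x, t)) = (LINT z:open_cyl|lborel. h z)"
proof -
  define H where "H z = indicator open_cyl z *\<^sub>R h z" for z
  have int: "integrable (lborel \<Otimes>\<^sub>M lborel) (\<lambda>(x, t). H (x, t))"
    using assms by (simp add: set_integrable_def H_def[abs_def] lborel_prod split_def)
  have meas: "H \<in> borel_measurable (lborel \<Otimes>\<^sub>M lborel)"
    using borel_measurable_integrable[OF int] by (simp add: split_def)
  have slice: "(LINT x:half_ball 2|lebesgue. h (x, t)) = (\<integral>x. H (x, t) \<partial>lborel)" if "t \<in> {0<..<4}" for t
  proof -
    have "(\<lambda>x. H (x, t)) \<in> borel_measurable lborel"
      using measurable_compose[OF measurable_Pair2' meas] by simp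
    then have "(\<integral>x. H (x, t) \<partial>lebesgue) = (\<integral>x. H (x, t) \<partial>lborel)" by (rule integral_completion)
    moreover have "(\<lambda>x. H (x, t)) = (\<lambda>x. indicator (half_ball 2) x *\<^sub>R h (x, t))"
      using that by (auto simp: H_def indicator_def)
    ultimately show ?thesis by (simp add: set_lebesgue_integral_def)
  qed
  have "(LINT t:{0<..<4}|lebesgue. LINT x:half_ball 2|lebesgue. h (x, t))
      = (\<integral>t. (\<integral>x. H (x, t) \<partial>lborel) \<partial>lebesgue)"
    unfolding set_lebesgue_integral_def[of lebesgue "{0<..<4}"]
    by (intro Bochner_Integration.integral_cong) (auto simp: indicator_def H_def slice)
  also have "\<dots> = (\<integral>t. (\<integral>x. H (x, t) \<partial>lborel) \<partial>lborel)"
  proof (rule integral_completion)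
    have "(\<lambda>(t, x). H (x, t)) \<in> borel_measurable (lborel \<Otimes>\<^sub>M lborel)"
      using measurable_compose[OF measurable_pair_swap' meas] by (simp add: case_prod_unfold)
    then show "(\<lambda>t. \<integral>x. H (x, t) \<partial>lborel) \<in> borel_measurable lborel"
      by (rule lborel.borel_measurable_lebesgue_integral)
  qed
  also have "\<dots> = (\<integral>z. H z \<partial>(lborel \<Otimes>\<^sub>M lborel))"
    using lborel_pair.integral_snd[OF int] by simp
  finally show ?thesis
    by (simp add: set_lebesgue_integral_def H_def lborel_prod)
qed

text \<open>
  Throughout this block \<open>\<Phi>\<close> is a test field and \<open>K\<close> carries its support.  Derivatives
  within \<open>dom_DT\<close> are ordinary derivatives in the open cylinder; on the flat boundary their continuity is
  all that enters.
\<close>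

context
  fixes \<Phi> :: "('m::finite) pt \<times> real \<Rightarrow> 'm pt" and K :: "('m pt \<times> real) set"
  assumes test: "test_field \<Phi>"
    and K: "compact K" "K \<subseteq> dom_DT" "\<And>z. z \<in> dom_DT - K \<Longrightarrow> \<Phi> z = 0"
begin

abbreviation (input) D :: "'m pt \<times> real \<Rightarrow> ('m pt \<times> real \<Rightarrow> 'm pt) \<Rightarrow> 'm pt \<times> real \<Rightarrow> 'm pt" where
  "D \<equiv> dir_deriv dom_DT"

lemma test_field_differentiable:
  "\<Phi> differentiable_on dom_DT" "D v \<Phi> differentiable_on dom_DT"
  using test unfolding test_field_def numeral_2_eq_2 Ck_on.simps by blast+

lemma test_field_continuous:
  "continuous_on dom_DT \<Phi>" "continuous_on dom_DT (D v \<Phi>)" "continuous_on dom_DT (D w (D v \<Phi>))"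
  using test unfolding test_field_def numeral_2_eq_2 Ck_on.simps
  by (blast intro: differentiable_imp_continuous_on)+

lemma test_field_vanishes:
  assumes "z \<in> open_cyl - K"
  shows "\<Phi> z = 0" "D v \<Phi> z = 0" "D w (D v \<Phi>) z = 0"
proof -
  have 0: "\<Phi> z = 0" if "z \<in> open_cyl - K" for z using K(3) that open_cyl_subset by blast
  note off = dir_deriv_eq_0_off_support[OF open_open_cyl open_cyl_subset compact_imp_closed[OF K(1)]]
  have 1: "D v \<Phi> z = 0" if "z \<in> open_cyl - K" for z v by (rule off[OF 0 that])
  show "\<Phi> z = 0" "D v \<Phi> z = 0" "D w (D v \<Phi>) z = 0"
    by (rule 0[OF assms], rule 1[OF assms], rule off[OF 1 assms])
qed

lemma test_field_line_derivative:
  assumes "z \<in> open_cyl"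
  shows "((\<lambda>\<tau>. \<Phi> (z + \<tau> *\<^sub>R v) \<bullet> e) has_real_derivative D v \<Phi> z \<bullet> e) (at 0)"
    "((\<lambda>\<tau>. D w \<Phi> (z + \<tau> *\<^sub>R v) \<bullet> e) has_real_derivative D v (D w \<Phi>) z \<bullet> e) (at 0)"
  unfolding has_real_derivative_iff_has_vector_derivative
  by (intro bounded_linear.has_vector_derivative[OF bounded_linear_inner_left]
      has_vector_derivative_along_line
      has_derivative_dir_deriv[OF open_open_cyl assms open_cyl_subset] test_field_differentiable)+

lemma test_field_set_integrable:
  fixes h :: "'m pt \<times> real \<Rightarrow> real"
  assumes "continuous_on dom_DT h" "\<And>z. z \<in> open_cyl - K \<Longrightarrow> h z = 0"
  shows "set_integrable lborel open_cyl h"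
  by (rule set_integrable_compact_support[OF assms(1) K(1,2)]) (use assms(2) open_open_cyl in auto)

lemma test_field_flux:
  fixes f g :: "'m pt \<times> real \<Rightarrow> real"
  assumes "continuous_on dom_DT f" "continuous_on dom_DT g"
    and "\<And>z. z \<in> open_cyl - K \<Longrightarrow> f z = 0" "\<And>z. z \<in> open_cyl - K \<Longrightarrow> g z = 0"
    and "\<And>z. z \<in> open_cyl \<Longrightarrow> ((\<lambda>\<tau>. f (z + \<tau> *\<^sub>R e)) has_real_derivative g z) (at 0)"
    and "snd (fst e) = 0 \<or> 0 < snd (fst e) \<and> (\<forall>z\<in>dom_DT. snd (fst z) = 0 \<longrightarrow> f z = 0)"
  shows "set_integrable lborel open_cyl g" "(LINT z:open_cyl|lborel. g z) = 0"
proof -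
  note flux = integral_line_derivative_eq_0[where S = "dom_DT :: ('m pt \<times> real) set" and \<nu> = "((0, 1), 0)",
      folded open_cyl_eq, OF _ open_open_cyl K(1) assms(3,4) K(2) assms(1,2,5)]
  show "set_integrable lborel open_cyl g" "(LINT z:open_cyl|lborel. g z) = 0"
    by (rule flux; use assms(6) in \<open>auto simp: inner_prod_def zero_prod_def\<close>)+
qed

text \<open>
  With \<open>v\<close> the mode, \<open>e\<close> tangential and \<open>q = v\<^sub>x\<^sub>x - v\<^sub>t\<close>, the integrand \<open>v (\<Delta>\<Phi> + \<Phi>\<^sub>t) \<bullet> e\<close> is a sum of
  line derivatives without boundary flux: in each space direction \<open>b\<close> the derivative of
  \<open>v (\<partial>\<^sub>b\<Phi> \<bullet> e)\<close>, corrected by \<open>- v\<^sub>x (\<Phi> \<bullet> e)\<close> in the normal direction; in time the derivative of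
  \<open>v (\<Phi> \<bullet> e)\<close>; and, for the remaining term \<open>q (\<Phi> \<bullet> e)\<close>, the divergence of \<open>q (x \<bullet> e) \<Phi>\<close>, which equals it
  because \<open>\<Phi>\<close> is divergence free.  The last part is the pressure \<open>q (x \<bullet> e)\<close> tested against \<open>\<Phi>\<close>.
\<close>

lemma test_field_shear_mode:
  fixes e :: "'m pt"
  assumes e: "snd e = 0"
  shows "(LINT z:open_cyl|lborel. shear_mode l (snd (fst z)) (snd z) *
      (laplacian dom_DT \<Phi> z \<bullet> e + time_deriv dom_DT \<Phi> z \<bullet> e)) = 0"
proof -
  define v where "v z = shear_mode l (snd (fst z)) (snd z)" for z :: "'m pt \<times> real"
  define vx where "vx z = shear_mode_x l (snd (fst z)) (snd z)" for z :: "'m pt \<times> real"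
  define vxx where "vxx z = shear_mode_xx l (snd (fst z)) (snd z)" for z :: "'m pt \<times> real"
  define vt where "vt z = shear_mode_t l (snd (fst z)) (snd z)" for z :: "'m pt \<times> real"
  define q where "q z = 2 * l\<^sup>2 * sin (2 * l\<^sup>2 * snd z)" for z :: "'m pt \<times> real"
  have cont [continuous_intros]: "continuous_on A v" "continuous_on A vx" "continuous_on A vxx"
    "continuous_on A vt" "continuous_on A q" for A
    unfolding v_def[abs_def] vx_def[abs_def] vxx_def[abs_def] vt_def[abs_def] q_def[abs_def]
    by (intro continuous_intros)+
  note [continuous_intros] = test_field_continuous
  have bdry: "\<Phi> z = 0" "v z = 0" if "z \<in> dom_DT" "snd (fst z) = 0" for z
    using that test by (auto simp: test_field_def v_def)
  have vline: "((\<lambda>\<tau>. v (z + \<tau> *\<^sub>R (b, c))) has_real_derivative snd b * vx z + c * vt z) (at 0)"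
    and vxline: "((\<lambda>\<tau>. vx (z + \<tau> *\<^sub>R (b, 0))) has_real_derivative snd b * vxx z) (at 0)" for z b c
    using shear_mode_line_derivative[of l "snd (fst z)" "snd b" "snd z" c]
      shear_mode_x_line_derivative[of l "snd (fst z)" "snd b" "snd z"]
    by (simp_all add: v_def vx_def vt_def vxx_def)
  have heat: "vxx z - vt z = q z" for z
    unfolding vxx_def vt_def q_def by (rule shear_mode_heat)
  \<comment> \<open>\<open>snd b\<close> is 1 for the normal direction and 0 for the tangential ones.\<close>
  define S where "S b z = v z * (D (b, 0) (D (b, 0) \<Phi>) z \<bullet> e) - snd b * (vxx z * (\<Phi> z \<bullet> e))" for b z
  have S: "set_integrable lborel open_cyl (S b)" "(LINT z:open_cyl|lborel. S b z) = 0" if b: "b \<in> Basis" for b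
  proof -
    let ?f = "\<lambda>z. v z * (D (b, 0) \<Phi> z \<bullet> e) - snd b * (vx z * (\<Phi> z \<bullet> e))"
    have sq: "snd b = 0 \<or> snd b = 1" using b by (simp add: snd_Basis_pt)
    have d: "((\<lambda>\<tau>. ?f (z + \<tau> *\<^sub>R (b, 0))) has_real_derivative S b z) (at 0)" if "z \<in> open_cyl" for z
    proof -
      have "((\<lambda>\<tau>. ?f (z + \<tau> *\<^sub>R (b, 0))) has_real_derivative
         (snd b * vx z + 0 * vt z) * (D (b, 0) \<Phi> (z + 0 *\<^sub>R (b, 0)) \<bullet> e)
          + D (b, 0) (D (b, 0) \<Phi>) z \<bullet> e * v (z + 0 *\<^sub>R (b, 0))
         - snd b * ((snd b * vxx z) * (\<Phi> (z + 0 *\<^sub>R (b, 0)) \<bullet> e) + D (b, 0) \<Phi> z \<bullet> e * vx (z + 0 *\<^sub>R (b, 0)))) (at 0)"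
        by (intro DERIV_diff DERIV_cmult DERIV_mult vline vxline test_field_line_derivative that)
      then show ?thesis
        by (rule back_subst[where P = "\<lambda>d. (_ has_real_derivative d) _"])
          (use sq in \<open>elim disjE; simp add: S_def algebra_simps del: scaleR_Pair\<close>)
    qed
    have "snd (fst (b, 0::real)) = 0 \<or> 0 < snd (fst (b, 0::real)) \<and>
        (\<forall>z\<in>dom_DT. snd (fst z) = 0 \<longrightarrow> ?f z = 0)"
      using b bdry by (simp add: snd_Basis_pt)
    note s = this
    have c: "continuous_on dom_DT ?f" "continuous_on dom_DT (S b)"
      unfolding S_def[abs_def] by (intro continuous_intros)+
    have 0: "?f z = 0" "S b z = 0" if "z \<in> open_cyl - K" for z
      using test_field_vanishes[OF that] by (simp_all add: S_def)
    show "set_integrable lborel open_cyl (S b)" "(LINT z:open_cyl|lborel. S b z) = 0"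
      by (rule test_field_flux[OF c 0 d s]; assumption)+
  qed
  define T where "T z = vt z * (\<Phi> z \<bullet> e) + v z * (D (0, 1) \<Phi> z \<bullet> e)" for z
  have T: "set_integrable lborel open_cyl T" "(LINT z:open_cyl|lborel. T z) = 0"
  proof -
    let ?f = "\<lambda>z. v z * (\<Phi> z \<bullet> e)"
    have d: "((\<lambda>\<tau>. ?f (z + \<tau> *\<^sub>R (0, 1))) has_real_derivative T z) (at 0)" if "z \<in> open_cyl" for z
      using DERIV_mult[OF vline[of z 0 1] test_field_line_derivative(1)[OF that, of "(0, 1)" e]]
      by (simp add: T_def algebra_simps del: scaleR_Pair)
    have "snd (fst ((0::'m pt), 1::real)) = 0 \<or> 0 < snd (fst ((0::'m pt), 1::real)) \<and>
        (\<forall>z\<in>dom_DT. snd (fst z) = 0 \<longrightarrow> ?f z = 0)" by simp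
    note s = this
    have c: "continuous_on dom_DT ?f" "continuous_on dom_DT T"
      unfolding T_def[abs_def] by (intro continuous_intros)+
    have 0: "?f z = 0" "T z = 0" if "z \<in> open_cyl - K" for z
      using test_field_vanishes[OF that] by (simp_all add: T_def)
    show "set_integrable lborel open_cyl T" "(LINT z:open_cyl|lborel. T z) = 0"
      by (rule test_field_flux[OF c 0 d s]; assumption)+
  qed
  define P where "P b z = q z * ((b \<bullet> e) * (\<Phi> z \<bullet> b) + (fst z \<bullet> e) * (D (b, 0) \<Phi> z \<bullet> b))" for b z
  have P: "set_integrable lborel open_cyl (P b)" "(LINT z:open_cyl|lborel. P b z) = 0" if b: "b \<in> Basis" for b
  proof -
    let ?f = "\<lambda>z. q z * ((fst z \<bullet> e) * (\<Phi> z \<bullet> b))"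
    have d: "((\<lambda>\<tau>. ?f (z + \<tau> *\<^sub>R (b, 0))) has_real_derivative P b z) (at 0)" if "z \<in> open_cyl" for z
    proof -
      have "((\<lambda>\<tau>. (fst z + \<tau> *\<^sub>R b) \<bullet> e) has_real_derivative b \<bullet> e) (at 0)"
        unfolding inner_add_left inner_scaleR_left by (auto intro!: derivative_eq_intros)
      from DERIV_mult[OF this test_field_line_derivative(1)[OF that, of "(b, 0)" b]]
      have "((\<lambda>\<tau>. q z * (((fst z + \<tau> *\<^sub>R b) \<bullet> e) * (\<Phi> (z + \<tau> *\<^sub>R (b, 0)) \<bullet> b))) has_real_derivative
          q z * ((b \<bullet> e) * (\<Phi> (z + 0 *\<^sub>R (b, 0)) \<bullet> b) + D (b, 0) \<Phi> z \<bullet> b * ((fst z + 0 *\<^sub>R b) \<bullet> e))) (at 0)"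
        by (rule DERIV_cmult)
      moreover have "q (z + \<tau> *\<^sub>R (b, 0)) = q z" "fst (z + \<tau> *\<^sub>R (b, 0)) = fst z + \<tau> *\<^sub>R b" for \<tau>
        by (simp_all add: q_def)
      ultimately show ?thesis by (simp add: P_def mult.commute del: scaleR_Pair)
    qed
    have "snd (fst (b, 0::real)) = 0 \<or> 0 < snd (fst (b, 0::real)) \<and>
        (\<forall>z\<in>dom_DT. snd (fst z) = 0 \<longrightarrow> ?f z = 0)"
      using b bdry by (simp add: snd_Basis_pt)
    note s = this
    have c: "continuous_on dom_DT ?f" "continuous_on dom_DT (P b)"
      unfolding P_def[abs_def] by (intro continuous_intros)+
    have 0: "?f z = 0" "P b z = 0" if "z \<in> open_cyl - K" for z
      using test_field_vanishes[OF that] by (simp_all add: P_def)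
    show "set_integrable lborel open_cyl (P b)" "(LINT z:open_cyl|lborel. P b z) = 0"
      by (rule test_field_flux[OF c 0 d s]; assumption)+
  qed
  have "v z * (laplacian dom_DT \<Phi> z \<bullet> e + time_deriv dom_DT \<Phi> z \<bullet> e)
      = (\<Sum>b\<in>Basis. S b z) + T z + (\<Sum>b\<in>Basis. P b z)" if "z \<in> open_cyl" for z
  proof -
    have "(\<Sum>b\<in>Basis. S b z) = v z * (laplacian dom_DT \<Phi> z \<bullet> e) - vxx z * (\<Phi> z \<bullet> e)"
      unfolding S_def sum_subtractf sum_Basis_snd
      by (simp add: laplacian_def space_deriv_def inner_sum_left sum_distrib_left)
    moreover have "(\<Sum>b\<in>Basis. P b z) = q z * (\<Phi> z \<bullet> e)"
    proof -
      have "(\<Sum>b\<in>Basis. D (b, 0) \<Phi> z \<bullet> b) = 0"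
        using test that open_cyl_subset by (auto simp: test_field_def divergence_def space_deriv_def)
      then have "(\<Sum>b\<in>Basis. (fst z \<bullet> e) * (D (b, 0) \<Phi> z \<bullet> b)) = 0"
        by (simp flip: sum_distrib_left)
      moreover have "(\<Sum>b\<in>Basis. (b \<bullet> e) * (\<Phi> z \<bullet> b)) = \<Phi> z \<bullet> e"
        unfolding euclidean_inner[of "\<Phi> z" e]
        by (intro sum.cong refl) (simp add: inner_commute mult.commute)
      ultimately show ?thesis
        unfolding P_def by (simp add: sum.distrib flip: sum_distrib_left)
    qed
    ultimately show ?thesis
      by (simp add: T_def time_deriv_def algebra_simps flip: heat)
  qed
  then have "(LINT z:open_cyl|lborel. v z * (laplacian dom_DT \<Phi> z \<bullet> e + time_deriv dom_DT \<Phi> z \<bullet> e))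
      = (LINT z:open_cyl|lborel. (\<Sum>b\<in>Basis. S b z) + T z + (\<Sum>b\<in>Basis. P b z))"
    by (intro set_lebesgue_integral_cong) (use open_open_cyl borel_open in auto)
  also have "\<dots> = 0"
    using S T P by (simp add: set_integral_zero_sum)
  finally show ?thesis unfolding v_def .
qed

text \<open>
  Exchange of sum and integral: each mode contributes zero, and the weights \<open>2\<^sup>-\<^sup>k\<close> dominate the series.
\<close>

lemma test_field_shear:
  fixes e :: "'m pt"
  assumes e: "snd e = 0" and \<kappa>: "\<And>k. 0 \<le> \<kappa> k"
  shows "(LINT z:open_cyl|lborel. shear \<kappa> (snd (fst z)) (snd z) *
      (laplacian dom_DT \<Phi> z \<bullet> e + time_deriv dom_DT \<Phi> z \<bullet> e)) = 0"
proof -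
  define h where "h z = laplacian dom_DT \<Phi> z \<bullet> e + time_deriv dom_DT \<Phi> z \<bullet> e" for z
  define w where "w k z = (1/2) ^ k * shear_mode (\<kappa> k) (snd (fst z)) (snd z)" for k and z :: "'m pt \<times> real"
  define F where "F k z = indicator open_cyl z *\<^sub>R (w k z * h z)" for k z
  note [continuous_intros] = test_field_continuous
  have h: "continuous_on dom_DT h"
    unfolding h_def[abs_def] laplacian_def[abs_def] time_deriv_def[abs_def] space_deriv_def[abs_def]
    by (intro continuous_intros)
  have h0: "h z = 0" if "z \<in> open_cyl - K" for z
    using test_field_vanishes[OF that] by (simp add: h_def laplacian_def time_deriv_def space_deriv_def)
  have hint: "integrable lborel (\<lambda>z. indicator open_cyl z *\<^sub>R \<bar>h z\<bar>)"
    unfolding set_integrable_def[symmetric]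
    by (rule test_field_set_integrable) (use h h0 in \<open>auto intro: continuous_intros\<close>)
  have Fint: "integrable lborel (F k)" for k
    unfolding F_def[abs_def] set_integrable_def[symmetric] w_def
    by (rule test_field_set_integrable) (use h0 in \<open>auto intro!: continuous_intros h\<close>)
  have F_le: "\<bar>F k z\<bar> \<le> (1/2) ^ k * (2 * (indicator open_cyl z *\<^sub>R \<bar>h z\<bar>))" for k z
  proof (cases "z \<in> open_cyl")
    case True
    then have "0 \<le> snd (fst z)" using dom_DT_snd_fst open_cyl_subset by blast
    then have "\<bar>w k z\<bar> \<le> (1/2) ^ k * 2"
      unfolding w_def by (rule shear_term_le[where \<kappa> = \<kappa>, OF \<kappa>])
    then show ?thesis using mult_right_mono[of "\<bar>w k z\<bar>" "(1/2) ^ k * 2" "\<bar>h z\<bar>"] True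
      by (simp add: F_def abs_mult)
  qed (simp add: F_def)
  have "(\<integral>z. F k z \<partial>lborel) = (1/2) ^ k * (LINT z:open_cyl|lborel. shear_mode (\<kappa> k) (snd (fst z)) (snd z) * h z)" for k
    by (simp add: F_def w_def set_lebesgue_integral_def ac_simps flip: integral_mult_right_zero)
  then have F0: "(\<integral>z. F k z \<partial>lborel) = 0" for k
    using test_field_shear_mode[OF e] by (simp add: h_def)
  have "(\<integral>z. (\<Sum>k. F k z) \<partial>lborel) = (\<Sum>k. \<integral>z. F k z \<partial>lborel)"
  proof (rule integral_suminf[OF Fint])
    show "AE z in lborel. summable (\<lambda>k. norm (F k z))"
      by (rule AE_I2, rule summable_comparison_test'[OF summable_half_powers, of 0]) (use F_le in auto)
    show "summable (\<lambda>k. \<integral>z. norm (F k z) \<partial>lborel)"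
    proof (rule summable_comparison_test'[OF summable_half_powers, of 0])
      fix k
      have "(\<integral>z. norm (F k z) \<partial>lborel)
          \<le> (\<integral>z. (1/2) ^ k * (2 * (indicator open_cyl z *\<^sub>R \<bar>h z\<bar>)) \<partial>lborel)"
        by (intro integral_mono integrable_norm Fint integrable_mult_right hint) (use F_le in auto)
      then show "norm (\<integral>z. norm (F k z) \<partial>lborel)
          \<le> (1/2) ^ k * (2 * (\<integral>z. indicator open_cyl z *\<^sub>R \<bar>h z\<bar> \<partial>lborel))"
        by simp
    qed
  qed
  moreover have "(\<Sum>k. F k z) = indicator open_cyl z *\<^sub>R (shear \<kappa> (snd (fst z)) (snd z) * h z)" for z
  proof (cases "z \<in> open_cyl")
    case True
    then have "0 \<le> snd (fst z)" using dom_DT_snd_fst open_cyl_subset by blast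
    then have "summable (\<lambda>k. w k z)"
      unfolding w_def by (rule summable_rabs_cancel[OF summable_shear[where \<kappa> = \<kappa>, OF \<kappa>]])
    then have "(\<Sum>k. w k z * h z) = (\<Sum>k. w k z) * h z"
      by (rule suminf_mult2[symmetric])
    then show ?thesis using True by (simp add: F_def w_def shear_def)
  qed (simp add: F_def)
  ultimately show ?thesis using F0 by (simp add: set_lebesgue_integral_def h_def)
qed

text \<open>
  The profile does not change in the direction of the flow, so the convective integrand is itself a
  derivative along the flow.
\<close>

lemma test_field_shear_convection:
  fixes e :: "'m pt"
  assumes e: "snd e = 0" and \<kappa>: "\<And>k. 0 \<le> \<kappa> k"
  shows "set_integrable lborel open_cyl (\<lambda>z. (shear \<kappa> (snd (fst z)) (snd z))\<^sup>2 * (D (e, 0) \<Phi> z \<bullet> e))"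
    "(LINT z:open_cyl|lborel. (shear \<kappa> (snd (fst z)) (snd z))\<^sup>2 * (D (e, 0) \<Phi> z \<bullet> e)) = 0"
proof -
  define V where "V z = (shear \<kappa> (snd (fst z)) (snd z))\<^sup>2" for z :: "'m pt \<times> real"
  have V: "continuous_on dom_DT V"
    unfolding V_def[abs_def]
    by (intro continuous_intros continuous_on_shear \<kappa> dom_DT_snd_fst)
  have c: "continuous_on dom_DT (\<lambda>z. V z * (\<Phi> z \<bullet> e))"
    "continuous_on dom_DT (\<lambda>z. V z * (D (e, 0) \<Phi> z \<bullet> e))"
    by (intro continuous_intros V test_field_continuous)+
  have 0: "V z * (\<Phi> z \<bullet> e) = 0" "V z * (D (e, 0) \<Phi> z \<bullet> e) = 0" if "z \<in> open_cyl - K" for z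
    using test_field_vanishes[OF that] by simp_all
  have d: "((\<lambda>\<tau>. V (z + \<tau> *\<^sub>R (e, 0)) * (\<Phi> (z + \<tau> *\<^sub>R (e, 0)) \<bullet> e)) has_real_derivative
      V z * (D (e, 0) \<Phi> z \<bullet> e)) (at 0)" if "z \<in> open_cyl" for z
  proof -
    have "V (z + \<tau> *\<^sub>R (e, 0)) = V z" for \<tau> using e by (simp add: V_def)
    then show ?thesis
      using DERIV_cmult[OF test_field_line_derivative(1)[OF that, of "(e, 0)" e], of "V z"] by simp
  qed
  have s: "snd (fst (e, 0::real)) = 0 \<or> 0 < snd (fst (e, 0::real)) \<and>
      (\<forall>z\<in>dom_DT. snd (fst z) = 0 \<longrightarrow> V z * (\<Phi> z \<bullet> e) = 0)" using e by simp
  show "set_integrable lborel open_cyl (\<lambda>z. (shear \<kappa> (snd (fst z)) (snd z))\<^sup>2 * (D (e, 0) \<Phi> z \<bullet> e))"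
    "(LINT z:open_cyl|lborel. (shear \<kappa> (snd (fst z)) (snd z))\<^sup>2 * (D (e, 0) \<Phi> z \<bullet> e)) = 0"
    by (rule test_field_flux[OF c 0 d s, unfolded V_def]; assumption)+
qed

lemma test_field_shear_integrable:
  fixes e :: "'m pt"
  assumes \<kappa>: "\<And>k. 0 \<le> \<kappa> k"
  shows "set_integrable lborel open_cyl (\<lambda>z. shear \<kappa> (snd (fst z)) (snd z) * (laplacian dom_DT \<Phi> z \<bullet> e))"
    "set_integrable lborel open_cyl (\<lambda>z. shear \<kappa> (snd (fst z)) (snd z) * (time_deriv dom_DT \<Phi> z \<bullet> e))"
proof -
  note [continuous_intros] = test_field_continuous
  show "set_integrable lborel open_cyl (\<lambda>z. shear \<kappa> (snd (fst z)) (snd z) * (laplacian dom_DT \<Phi> z \<bullet> e))"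
    "set_integrable lborel open_cyl (\<lambda>z. shear \<kappa> (snd (fst z)) (snd z) * (time_deriv dom_DT \<Phi> z \<bullet> e))"
    unfolding laplacian_def[abs_def] time_deriv_def[abs_def] space_deriv_def[abs_def]
    by (rule test_field_set_integrable, intro continuous_intros continuous_on_shear \<kappa> dom_DT_snd_fst,
        assumption?, simp add: test_field_vanishes)+
qed

end

definition shear_flow :: "(nat \<Rightarrow> real) \<Rightarrow> 'm pt \<Rightarrow> ('m::finite) pt \<times> real \<Rightarrow> 'm pt" where
  "shear_flow \<kappa> e z = shear \<kappa> (snd (fst z)) (snd z) *\<^sub>R e"

lemma shear_flow_continuous:
  assumes "\<And>k. 0 \<le> \<kappa> k"
  shows "continuous_on {z. 0 \<le> snd (fst z)} (shear_flow \<kappa> e)"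
  unfolding shear_flow_def[abs_def]
  by (intro continuous_intros continuous_on_shear assms) auto

lemma in_Lp_loc_continuous:
  fixes u :: "'a::euclidean_space \<Rightarrow> 'b::euclidean_space"
  assumes "continuous_on S u" "0 < p"
  shows "in_Lp_loc p S u"
  unfolding in_Lp_loc_def in_Lp_def
proof (intro allI impI conjI)
  fix C assume C: "compact C \<and> C \<subseteq> S"
  then have u: "continuous_on C u" using assms(1) continuous_on_subset by blast
  have leb: "set_borel_measurable lebesgue C f" if "continuous_on C f" for f :: "'a \<Rightarrow> 'c::euclidean_space"
  proof -
    have "(\<lambda>z. indicator C z *\<^sub>R f z) \<in> borel_measurable borel"
      using that C by (intro borel_measurable_continuous_on_indicator) (auto intro: borel_compact)
    then show ?thesis unfolding set_borel_measurable_def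
      by (intro measurable_completion) simp
  qed
  show "set_borel_measurable lebesgue C u" by (rule leb[OF u])
  have c: "continuous_on C (\<lambda>z. norm (u z) powr p)"
    by (rule continuous_on_powr') (use u assms(2) in \<open>auto intro!: continuous_intros\<close>)
  then have "integrable lborel (\<lambda>z. indicator C z *\<^sub>R norm (u z) powr p)"
    using C by (intro borel_integrable_compact) auto
  then show "set_integrable lebesgue C (\<lambda>z. norm (u z) powr p)"
    unfolding set_integrable_def by (subst integrable_completion) (auto intro: borel_measurable_integrable)
qed

lemma shear_flow_in_Lp_loc:
  assumes "\<And>k. 0 \<le> \<kappa> k" "0 < p"
  shows "in_Lp_loc p dom_DT (shear_flow \<kappa> e)"
  by (rule in_Lp_loc_continuous[OF continuous_on_subset[OF shear_flow_continuous[where \<kappa> = \<kappa>, OF assms(1)]] assms(2)])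
    (use dom_DT_snd_fst in auto)

text \<open>
  At a fixed time the integrand \<open>V \<partial>\<^sub>e\<Psi>\<close> is the tangential derivative of \<open>V \<Psi>\<close>.
\<close>

lemma shear_flow_weakly_div_free:
  fixes e :: "('m::finite) pt"
  assumes \<kappa>: "\<And>k. 0 \<le> \<kappa> k" and e: "e \<in> Basis" "snd e = 0"
  shows "weakly_div_free (shear_flow \<kappa> e)"
  unfolding weakly_div_free_def
proof (intro ballI allI impI)
  fix t :: real and \<Psi> :: "'m pt \<Rightarrow> real"
  assume \<Psi>: "Ck_on 1 dom_D \<Psi> \<and> compact_support_in dom_D \<Psi> \<and> (\<forall>x\<in>dom_D. snd x = 0 \<longrightarrow> \<Psi> x = 0)"
  then obtain K where K: "compact K" "K \<subseteq> dom_D" "\<And>x. x \<in> dom_D - K \<Longrightarrow> \<Psi> x = 0"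
    unfolding compact_support_in_def by blast
  have diff: "\<Psi> differentiable_on dom_D" and cont: "continuous_on dom_D (dir_deriv dom_D e \<Psi>)"
    using \<Psi> unfolding One_nat_def Ck_on.simps by blast+
  have sub: "half_ball 2 \<subseteq> dom_D" unfolding half_ball_eq by blast
  let ?v = "\<lambda>x::'m pt. shear \<kappa> (snd x) t"
  have v: "continuous_on dom_D ?v"
    by (intro continuous_intros continuous_on_shear \<kappa>) (auto simp: dom_D_eq)
  have 0: "?v x * \<Psi> x = 0" "?v x * dir_deriv dom_D e \<Psi> x = 0" if "x \<in> half_ball 2 - K" for x
  proof -
    have "\<Psi> x = 0" if "x \<in> half_ball 2 - K" for x using that K(3) sub by blast
    with that dir_deriv_eq_0_off_support[OF open_half_ball sub compact_imp_closed[OF K(1)] this that]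
    show "?v x * \<Psi> x = 0" "?v x * dir_deriv dom_D e \<Psi> x = 0" by simp_all
  qed
  have d: "((\<lambda>\<tau>. ?v (x + \<tau> *\<^sub>R e) * \<Psi> (x + \<tau> *\<^sub>R e)) has_real_derivative ?v x * dir_deriv dom_D e \<Psi> x) (at 0)"
    if "x \<in> half_ball 2" for x
  proof -
    have "((\<lambda>\<tau>. \<Psi> (x + \<tau> *\<^sub>R e)) has_real_derivative dir_deriv dom_D e \<Psi> x) (at 0)"
      unfolding has_real_derivative_iff_has_vector_derivative
      by (intro has_vector_derivative_along_line has_derivative_dir_deriv[OF open_half_ball that sub] diff)
    from DERIV_cmult[OF this, of "?v x"] show ?thesis using e by simp
  qed
  have grad: "shear_flow \<kappa> e (x, t) \<bullet> gradient dom_D \<Psi> x = ?v x * dir_deriv dom_D e \<Psi> x" for x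
    using e(1) by (simp add: shear_flow_def gradient_def inner_sum_right inner_Basis if_distrib
        cong: if_cong)
  note flux = integral_line_derivative_eq_0[where S = "dom_D :: 'm pt set" and \<nu> = "(0, 1)",
      folded half_ball_eq, OF _ open_half_ball K(1) 0 K(2) continuous_on_mult[OF v differentiable_imp_continuous_on[OF diff]]
      continuous_on_mult[OF v cont] d]
  have *: "set_integrable lborel (half_ball 2) (\<lambda>x. ?v x * dir_deriv dom_D e \<Psi> x)"
    "(LINT x:half_ball 2|lborel. ?v x * dir_deriv dom_D e \<Psi> x) = 0"
    by (rule flux; use e in \<open>auto simp: inner_prod_def zero_prod_def\<close>)+
  then have m: "(\<lambda>x. indicator (half_ball 2) x *\<^sub>R (?v x * dir_deriv dom_D e \<Psi> x)) \<in> borel_measurable lborel"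
    unfolding set_integrable_def by (intro borel_measurable_integrable)
  show "set_integrable lebesgue (half_ball 2) (\<lambda>x. shear_flow \<kappa> e (x, t) \<bullet> gradient dom_D \<Psi> x) \<and>
        (LINT x:half_ball 2|lebesgue. shear_flow \<kappa> e (x, t) \<bullet> gradient dom_D \<Psi> x) = 0"
    using * unfolding grad set_integrable_def set_lebesgue_integral_def
    by (simp only: integrable_completion[OF m] integral_completion[OF m])
qed

lemma tensor_contract_shear:
  fixes e :: "('m::finite) pt"
  assumes "e \<in> Basis"
  shows "tensor_contract S (c *\<^sub>R e) \<Phi> z = c\<^sup>2 * (dir_deriv S (e, 0) \<Phi> z \<bullet> e)"
proof -
  have "(\<Sum>j\<in>Basis. (c *\<^sub>R e \<bullet> i) * (c *\<^sub>R e \<bullet> j) * (space_deriv S i \<Phi> z \<bullet> j))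
      = (if i = e then c\<^sup>2 * (space_deriv S e \<Phi> z \<bullet> e) else 0)" if "i \<in> Basis" for i
  proof -
    have "(\<Sum>j\<in>Basis. (c *\<^sub>R e \<bullet> i) * (c *\<^sub>R e \<bullet> j) * (space_deriv S i \<Phi> z \<bullet> j))
        = (\<Sum>j\<in>Basis. if j = e then (c * (e \<bullet> i)) * c * (space_deriv S i \<Phi> z \<bullet> e) else 0)"
      using assms by (intro sum.cong) (auto simp: inner_Basis)
    also have "\<dots> = (c * (e \<bullet> i)) * c * (space_deriv S i \<Phi> z \<bullet> e)" using assms by simp
    finally show ?thesis using that assms by (simp add: inner_Basis power2_eq_square)
  qed
  then show ?thesis
    using assms by (simp add: tensor_contract_def space_deriv_def)
qed

theorem shear_flow_very_weak:
  fixes e :: "('m::finite) pt"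
  assumes \<kappa>: "\<And>k. 0 \<le> \<kappa> k" and e: "e \<in> Basis" "snd e = 0"
  shows "very_weak_stokes (shear_flow \<kappa> e)" "very_weak_navier_stokes (shear_flow \<kappa> e)"
proof -
  let ?u = "shear_flow \<kappa> e"
  let ?v = "\<lambda>z. shear \<kappa> (snd (fst z)) (snd z)"
  have eq: "- (LINT t:{0<..<4}|lebesgue. LINT x:half_ball 2|lebesgue. ?u (x, t) \<bullet> laplacian dom_DT \<Phi> (x, t))
      = (LINT t:{0<..<4}|lebesgue. LINT x:half_ball 2|lebesgue. ?u (x, t) \<bullet> time_deriv dom_DT \<Phi> (x, t))"
    "- (LINT t:{0<..<4}|lebesgue. LINT x:half_ball 2|lebesgue. ?u (x, t) \<bullet> laplacian dom_DT \<Phi> (x, t))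
      = (LINT t:{0<..<4}|lebesgue. LINT x:half_ball 2|lebesgue. ?u (x, t) \<bullet> time_deriv dom_DT \<Phi> (x, t)
          + tensor_contract dom_DT (?u (x, t)) \<Phi> (x, t))"
    if \<Phi>: "test_field \<Phi>" for \<Phi>
  proof -
    obtain K where K: "compact K" "K \<subseteq> dom_DT" "\<And>z. z \<in> dom_DT - K \<Longrightarrow> \<Phi> z = 0"
      using \<Phi> unfolding test_field_def compact_support_in_def by blast
    note int = test_field_shear_integrable[where e = e and \<kappa> = \<kappa>, OF \<Phi> K \<kappa>]
    note conv = test_field_shear_convection[where \<kappa> = \<kappa>, OF \<Phi> K e(2) \<kappa>]
    let ?A = "LINT z:open_cyl|lborel. ?v z * (laplacian dom_DT \<Phi> z \<bullet> e)"
    let ?B = "LINT z:open_cyl|lborel. ?v z * (time_deriv dom_DT \<Phi> z \<bullet> e)"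
    have A: "(LINT t:{0<..<4}|lebesgue. LINT x:half_ball 2|lebesgue. ?u (x, t) \<bullet> laplacian dom_DT \<Phi> (x, t)) = ?A"
      using iterated_integral_open_cyl[OF int(1)] by (simp add: shear_flow_def inner_commute)
    have B: "(LINT t:{0<..<4}|lebesgue. LINT x:half_ball 2|lebesgue. ?u (x, t) \<bullet> time_deriv dom_DT \<Phi> (x, t)) = ?B"
      using iterated_integral_open_cyl[OF int(2)] by (simp add: shear_flow_def inner_commute)
    have C: "(LINT t:{0<..<4}|lebesgue. LINT x:half_ball 2|lebesgue. ?u (x, t) \<bullet> time_deriv dom_DT \<Phi> (x, t)
        + tensor_contract dom_DT (?u (x, t)) \<Phi> (x, t)) = ?B"
      using iterated_integral_open_cyl[OF set_integral_add(1)[OF int(2) conv(1)]]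
        set_integral_add(2)[OF int(2) conv(1)] conv(2) e(1)
      by (simp add: shear_flow_def inner_commute tensor_contract_shear)
    have "?A + ?B = 0"
      using test_field_shear[where \<kappa> = \<kappa>, OF \<Phi> K e(2) \<kappa>] set_integral_add(2)[OF int] by (simp add: distrib_left)
    then show "- (LINT t:{0<..<4}|lebesgue. LINT x:half_ball 2|lebesgue. ?u (x, t) \<bullet> laplacian dom_DT \<Phi> (x, t))
      = (LINT t:{0<..<4}|lebesgue. LINT x:half_ball 2|lebesgue. ?u (x, t) \<bullet> time_deriv dom_DT \<Phi> (x, t))"
    "- (LINT t:{0<..<4}|lebesgue. LINT x:half_ball 2|lebesgue. ?u (x, t) \<bullet> laplacian dom_DT \<Phi> (x, t))
      = (LINT t:{0<..<4}|lebesgue. LINT x:half_ball 2|lebesgue. ?u (x, t) \<bullet> time_deriv dom_DT \<Phi> (x, t)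
          + tensor_contract dom_DT (?u (x, t)) \<Phi> (x, t))"
      unfolding A B C by simp_all
  qed
  note Lp = shear_flow_in_Lp_loc[where \<kappa> = \<kappa> and e = e, OF \<kappa>]
  note df = shear_flow_weakly_div_free[where \<kappa> = \<kappa>, OF \<kappa> e]
  show "very_weak_stokes ?u" "very_weak_navier_stokes ?u"
    unfolding very_weak_stokes_def very_weak_navier_stokes_def using eq Lp[of 1] Lp[of 2] df by simp_all
qed

lemma Linf_norm_shear_flow:
  fixes e :: "('m::finite) pt"
  assumes \<kappa>: "\<And>k. 0 \<le> \<kappa> k" and e: "e \<in> Basis"
  shows "Linf_norm (half_cyl 1) (shear_flow \<kappa> e) < \<infinity>"
proof -
  have cyl: "half_cyl 1 = half_ball 1 \<times> {0<..<1::real}" by (simp add: half_cyl_def)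
  have nn: "0 \<le> snd (fst z)" if "z \<in> (half_cyl 1 :: ('m pt \<times> real) set)" for z
    using that by (auto simp: half_cyl_def half_ball_def)
  have op: "open (half_cyl 1 :: ('m pt \<times> real) set)"
    unfolding cyl by (intro open_Times open_half_ball open_greaterThanLessThan)
  have "Linf_norm (half_cyl 1) (shear_flow \<kappa> e) \<le> ereal 4"
    unfolding Linf_norm_def
  proof (rule esssup_I)
    have "continuous_on (half_cyl 1) (shear_flow \<kappa> e)"
      by (rule continuous_on_subset[OF shear_flow_continuous[where \<kappa> = \<kappa>, OF \<kappa>]]) (use nn in auto)
    then have "shear_flow \<kappa> e \<in> borel_measurable (lebesgue_on (half_cyl 1))"
      using op by (intro continuous_imp_measurable_on_sets_lebesgue) auto
    then show "(\<lambda>z. ereal (norm (shear_flow \<kappa> e z))) \<in> borel_measurable (lebesgue_on (half_cyl 1))"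
      by measurable
    have "norm (shear_flow \<kappa> e z) \<le> 4" if "z \<in> half_cyl 1" for z
      using abs_shear_le[where \<kappa> = \<kappa>, OF \<kappa> nn[OF that]] e by (simp add: shear_flow_def)
    then show "AE z in lebesgue_on (half_cyl 1). ereal (norm (shear_flow \<kappa> e z)) \<le> ereal 4"
      by (intro AE_I2) (simp add: space_restrict_space)
  qed
  then show ?thesis by (rule le_less_trans) simp
qed

section \<open>Orthogonality of the modes in time\<close>

text \<open>
  The length \<open>1/4\<close> of the time interval is a period of \<open>cos (8 \<pi> n t)\<close>.
\<close>

lemma has_integral_cos_period:
  fixes n :: int
  shows "((\<lambda>t. cos (8 * pi * of_int n * t + y)) has_integral (if n = 0 then cos y / 4 else 0)) {3/4..1}"
proof (cases "n = 0")
  case True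
  then show ?thesis using has_integral_const_real[of "cos y" "3/4" 1] by simp
next
  case False
  let ?F = "\<lambda>t. sin (8 * pi * of_int n * t + y) / (8 * pi * of_int n)"
  have "((\<lambda>t. cos (8 * pi * of_int n * t + y)) has_integral (?F 1 - ?F (3/4))) {3/4..1}"
  proof (rule fundamental_theorem_of_calculus)
    fix t :: real
    show "(?F has_vector_derivative cos (8 * pi * of_int n * t + y)) (at t within {3/4..1})"
      unfolding has_real_derivative_iff_has_vector_derivative[symmetric]
      using False by (auto intro!: derivative_eq_intros)
  qed simp
  moreover have "sin (8 * pi * of_int n * 1 + y) = sin (8 * pi * of_int n * (3/4) + y)"
  proof -
    have "sin (y + 2 * pi * of_int (4 * n)) = sin (y + 2 * pi * of_int (3 * n))"
      by (simp only: sin_add sin_int_2pin cos_int_2pin)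
    then show ?thesis by (simp add: algebra_simps)
  qed
  ultimately show ?thesis using False by simp
qed

lemma has_integral_cos_cos:
  fixes M N :: int
  assumes "0 < M" "0 < N"
  shows "((\<lambda>t. cos (8 * pi * of_int M * t) * cos (8 * pi * of_int N * t - y)) has_integral
    (if M = N then cos y / 8 else 0)) {3/4..1}"
proof -
  have eq: "cos (8 * pi * of_int M * t) * cos (8 * pi * of_int N * t - y)
      = (cos (8 * pi * of_int (M + N) * t + (- y)) + cos (8 * pi * of_int (M - N) * t + y)) / 2" for t
    unfolding cos_times_cos by (simp add: algebra_simps)
  have "((\<lambda>t. (cos (8 * pi * of_int (M + N) * t + (- y)) + cos (8 * pi * of_int (M - N) * t + y)) / 2)
      has_integral ((if M + N = 0 then cos (- y) / 4 else 0) + (if M - N = 0 then cos y / 4 else 0)) / 2) {3/4..1}"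
    by (intro has_integral_divide has_integral_add has_integral_cos_period)
  then show ?thesis
    unfolding eq by (rule has_integral_eq_rhs) (use assms in auto)
qed

text \<open>
  The constant makes \<open>2 (freq r k)\<^sup>2 = 8 \<pi> 4\<^sup>r\<^sup>k\<close>, so every mode has \<open>1/4\<close> as a period in time.  The
  parameter \<open>r\<close> is the growth rate, to be taken large when \<open>p\<close> is close to 1.
\<close>

definition freq :: "nat \<Rightarrow> nat \<Rightarrow> real" where
  "freq r k = 2 * sqrt pi * 2 ^ (r * k)"

lemma freq_nonneg: "0 \<le> freq r k" and freq_pos: "0 < freq r k"
  by (auto simp: freq_def)

lemma freq_ge: "2 * 2 ^ (r * k) \<le> freq r k"
proof -
  have "1 \<le> sqrt pi" using pi_ge_two by simp
  then show ?thesis by (simp add: freq_def)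
qed

lemma two_freq_square: "2 * (freq r k)\<^sup>2 = 8 * pi * of_int (4 ^ (r * k))"
proof -
  have "((2::real) ^ (r * k))\<^sup>2 = 4 ^ (r * k)" by (simp add: power2_eq_square flip: power_mult_distrib)
  then show ?thesis by (simp add: freq_def power_mult_distrib)
qed

lemma has_integral_cos_shear_mode:
  assumes "0 < r"
  shows "((\<lambda>t. cos (2 * (freq r k)\<^sup>2 * t) * shear_mode (freq r j) x t) has_integral
    (if j = k then (1 - exp (- (freq r k * x)) * cos (freq r k * x)) / 8 else 0)) {3/4..1}"
proof -
  let ?M = "4 ^ (r * k) :: int" and ?N = "4 ^ (r * j) :: int"
  let ?c = "\<lambda>y t. cos (8 * pi * of_int ?M * t) * cos (8 * pi * of_int ?N * t - y)"
  have MN: "?M = ?N \<longleftrightarrow> j = k" using assms by auto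
  have "((\<lambda>t. ?c 0 t - exp (- (freq r j * x)) * ?c (freq r j * x) t) has_integral
     (if ?M = ?N then cos 0 / 8 else 0) - exp (- (freq r j * x)) * (if ?M = ?N then cos (freq r j * x) / 8 else 0)) {3/4..1}"
    by (intro has_integral_diff has_integral_mult_right has_integral_cos_cos) auto
  moreover have eq: "cos (2 * (freq r k)\<^sup>2 * t) * shear_mode (freq r j) x t
      = ?c 0 t - exp (- (freq r j * x)) * ?c (freq r j * x) t" for t
    unfolding shear_mode_def two_freq_square by (simp add: algebra_simps)
  ultimately show ?thesis
    unfolding eq MN by (elim has_integral_eq_rhs) (auto simp: diff_divide_distrib)
qed

lemma has_integral_imp_set_integral_Ioo:
  fixes f :: "real \<Rightarrow> real"
  assumes "(f has_integral c) {a..b}" "continuous_on {a..b} f"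
  shows "set_integrable lborel {a<..<b} f" "(LINT t:{a<..<b}|lborel. f t) = c"
proof -
  have i: "set_integrable lborel {a..b} f"
    unfolding set_integrable_def by (rule borel_integrable_compact) (use assms in auto)
  then show j: "set_integrable lborel {a<..<b} f" by (rule set_integrable_subset) auto
  show "(LINT t:{a<..<b}|lborel. f t) = c"
    using set_borel_integral_eq_integral(2)[OF j] assms(1)
    by (simp add: has_integral_Icc_iff_Ioo integral_unique)
qed

text \<open>
  By orthogonality only the \<open>k\<close>-th term of the series survives.
\<close>

lemma integral_cos_shear:
  assumes r: "0 < r" and x: "0 \<le> x"
  shows "(LINT t:{3/4<..<1}|lborel. cos (2 * (freq r k)\<^sup>2 * t) * shear (freq r) x t)
    = (1/2) ^ k * ((1 - exp (- (freq r k * x)) * cos (freq r k * x)) / 8)"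
proof -
  define m where "m j t = cos (2 * (freq r k)\<^sup>2 * t) * shear_mode (freq r j) x t" for j t
  define F where "F j t = (1/2) ^ j * (indicator {3/4<..<1} t *\<^sub>R m j t)" for j t
  let ?I = "\<lambda>t. indicator {3/4<..<1::real} t :: real"
  have cont: "continuous_on A (m j)" for A j unfolding m_def[abs_def] by (intro continuous_intros)
  have m: "set_integrable lborel {3/4<..<1} (m j)" "(LINT t:{3/4<..<1}|lborel. m j t)
      = (if j = k then (1 - exp (- (freq r k * x)) * cos (freq r k * x)) / 8 else 0)" for j
    using has_integral_imp_set_integral_Ioo[OF has_integral_cos_shear_mode[OF r, of k j x, folded m_def] cont] by auto
  have Fint: "integrable lborel (F j)" for j
    using m(1)[of j] unfolding F_def[abs_def] set_integrable_def by (rule integrable_mult_right)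
  have Fval: "(\<integral>t. F j t \<partial>lborel)
      = (if j = k then (1/2) ^ k * ((1 - exp (- (freq r k * x)) * cos (freq r k * x)) / 8) else 0)" for j
    using m(2)[of j] by (simp add: F_def set_lebesgue_integral_def)
  have F_le: "\<bar>F j t\<bar> \<le> (1/2) ^ j * (2 * ?I t)" for j t
  proof -
    have "\<bar>m j t\<bar> \<le> 1 * 2"
      unfolding m_def abs_mult
      by (intro mult_mono abs_cos_le_one abs_shear_mode_le freq_nonneg x) auto
    then show ?thesis by (auto simp: F_def abs_mult indicator_def)
  qed
  have Iint: "integrable lborel ?I" by (intro integrable_real_indicator) auto
  have "(\<integral>t. (\<Sum>j. F j t) \<partial>lborel) = (\<Sum>j. \<integral>t. F j t \<partial>lborel)"
  proof (rule integral_suminf[OF Fint])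
    show "AE t in lborel. summable (\<lambda>j. norm (F j t))"
      by (rule AE_I2, rule summable_comparison_test'[OF summable_half_powers, of 0]) (use F_le in auto)
    show "summable (\<lambda>j. \<integral>t. norm (F j t) \<partial>lborel)"
    proof (rule summable_comparison_test'[OF summable_half_powers, of 0])
      fix j
      have "(\<integral>t. norm (F j t) \<partial>lborel) \<le> (\<integral>t. (1/2) ^ j * (2 * ?I t) \<partial>lborel)"
        by (intro integral_mono integrable_norm Fint integrable_mult_right Iint) (use F_le in auto)
      then show "norm (\<integral>t. norm (F j t) \<partial>lborel) \<le> (1/2) ^ j * (2 * (\<integral>t. ?I t \<partial>lborel))"
        by simp
    qed
  qed
  also have "(\<lambda>t. \<Sum>j. F j t) = (\<lambda>t. indicator {3/4<..<1} t *\<^sub>R (cos (2 * (freq r k)\<^sup>2 * t) * shear (freq r) x t))"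
  proof
    fix t
    have "summable (\<lambda>j. (1/2) ^ j * shear_mode (freq r j) x t)"
      by (rule summable_rabs_cancel[OF summable_shear[where \<kappa> = "freq r", OF freq_nonneg x]])
    then have "(\<Sum>j. (indicator {3/4<..<1} t * cos (2 * (freq r k)\<^sup>2 * t)) * ((1/2) ^ j * shear_mode (freq r j) x t))
        = (indicator {3/4<..<1} t * cos (2 * (freq r k)\<^sup>2 * t)) * shear (freq r) x t"
      unfolding shear_def by (rule suminf_mult)
    then show "(\<Sum>j. F j t) = indicator {3/4<..<1} t *\<^sub>R (cos (2 * (freq r k)\<^sup>2 * t) * shear (freq r) x t)"
      by (simp add: F_def m_def ac_simps)
  qed
  also have "(\<Sum>j. \<integral>t. F j t \<partial>lborel) = (1/2) ^ k * ((1 - exp (- (freq r k * x)) * cos (freq r k * x)) / 8)"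
    unfolding Fval
    using sums_unique[OF sums_single[of k "\<lambda>_. (1/2) ^ k * ((1 - exp (- (freq r k * x)) * cos (freq r k * x)) / 8)"]]
    by simp
  finally show ?thesis by (simp add: set_lebesgue_integral_def)
qed

section \<open>Cut-off functions adapted to the boundary layers\<close>

text \<open>
  A bump on \<open>(1/4, 1)\<close>.  Evaluated at \<open>l x\<close> it localises to the boundary layer of the mode with wave
  number \<open>l\<close> while staying away from the boundary.
\<close>

definition layer_cut :: "real \<Rightarrow> real" where
  "layer_cut y = bump (y - 1/4) * bump (1 - y)"

definition layer_cut' :: "real \<Rightarrow> real" where
  "layer_cut' y = bump_deriv 1 (y - 1/4) * bump (1 - y) - bump (y - 1/4) * bump_deriv 1 (1 - y)"

lemma has_real_derivative_layer_cut:
  "(layer_cut has_real_derivative layer_cut' y) (at y)"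
proof -
  have "((\<lambda>y. bump (y - 1/4)) has_real_derivative bump_deriv 1 (y - 1/4) * 1) (at y)"
    by (rule DERIV_chain2[OF has_real_derivative_bump_deriv[of 0, folded One_nat_def]])
      (auto intro!: derivative_eq_intros)
  moreover have "((\<lambda>y. bump (1 - y)) has_real_derivative bump_deriv 1 (1 - y) * - 1) (at y)"
    by (rule DERIV_chain2[OF has_real_derivative_bump_deriv[of 0, folded One_nat_def]])
      (auto intro!: derivative_eq_intros)
  ultimately show ?thesis
    unfolding layer_cut_def[abs_def] layer_cut'_def
    by (rule DERIV_cong[OF DERIV_mult]) (simp add: algebra_simps)
qed

lemma layer_cut_outside: "y \<notin> {1/4<..<1} \<Longrightarrow> layer_cut y = 0"
  and layer_cut'_outside: "y \<notin> {1/4<..<1} \<Longrightarrow> layer_cut' y = 0"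
  by (auto simp: layer_cut_def layer_cut'_def bump_deriv_def)

lemma layer_cut_nonneg: "0 \<le> layer_cut y" and layer_cut_le_1: "layer_cut y \<le> 1"
  unfolding layer_cut_def by (auto intro: mult_le_one bump_nonneg bump_le_1 mult_nonneg_nonneg)

lemma layer_cut_pos: "y \<in> {1/4<..<1} \<Longrightarrow> 0 < layer_cut y"
  by (simp add: layer_cut_def bump_pos)

lemma continuous_on_layer_cut [continuous_intros]:
  assumes "continuous_on S f"
  shows "continuous_on S (\<lambda>z. layer_cut (f z))" "continuous_on S (\<lambda>z. layer_cut' (f z))"
  unfolding layer_cut_def layer_cut'_def by (intro continuous_intros assms)+

lemma layer_cut'_bounded: obtains B where "0 \<le> B" "\<And>y. \<bar>layer_cut' y\<bar> \<le> B"
proof -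
  have "compact (layer_cut' ` {0..1})"
    by (intro compact_continuous_image continuous_intros) auto
  then obtain B where B: "\<And>y. y \<in> {0..1} \<Longrightarrow> \<bar>layer_cut' y\<bar> \<le> B"
    using compact_imp_bounded by (fastforce simp: bounded_iff)
  have "0 \<le> B" using B[of 0] by auto
  moreover have "\<bar>layer_cut' y\<bar> \<le> B" for y
    using B[of y] layer_cut'_outside[of y] \<open>0 \<le> B\<close> by (cases "y \<in> {0..1}") auto
  ultimately show ?thesis using that by blast
qed

text \<open>
  What the rescaled \<open>k\<close>-th layer sees of its mode: the factor \<open>exp (- y) (cos y + sin y)\<close> is the derivative of
  \<open>1 - exp (- y) cos y\<close>, the amplitude of the mode in phase with \<open>cos (2 l\<^sup>2 t)\<close>.
\<close>

definition layer_constant :: real where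
  "layer_constant = integral {0..1} (\<lambda>y. layer_cut y * (exp (- y) * (cos y + sin y)))"

text \<open>
  Both \<open>cos\<close> and \<open>sin\<close> are nonnegative on the support of the bump, because \<open>1 < \<pi> / 2\<close>.
\<close>

lemma layer_constant_pos: "0 < layer_constant"
proof -
  let ?f = "\<lambda>y. layer_cut y * (exp (- y) * (cos y + sin y))"
  have cs: "0 < cos y + sin y" if "y \<in> {0..1}" for y :: real
  proof -
    have "0 \<le> sin y" using that pi_ge_two by (intro sin_ge_zero) auto
    moreover have "0 < cos y" using that pi_gt3 by (intro cos_gt_zero_pi) auto
    ultimately show ?thesis by simp
  qed
  have c: "continuous_on {0..1} ?f" by (intro continuous_intros)
  have nn: "0 \<le> ?f y" if "y \<in> {0..1}" for y
    using cs[OF that] layer_cut_nonneg[of y] by simp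
  have "?f (1/2) \<noteq> 0" using cs[of "1/2"] layer_cut_pos[of "1/2"] by simp
  then have "layer_constant \<noteq> 0"
    unfolding layer_constant_def using integral_eq_0_iff[OF c _ nn] by force
  moreover have "0 \<le> layer_constant"
    unfolding layer_constant_def by (rule integral_nonneg[OF integrable_continuous_real[OF c] nn])
  ultimately show ?thesis by simp
qed

lemma integral_layer_cut':
  "(\<integral>y. layer_cut' y * (1 - exp (- y) * cos y) \<partial>lborel) = - layer_constant"
proof -
  let ?m = "\<lambda>y::real. 1 - exp (- y) * cos y" and ?m' = "\<lambda>y::real. exp (- y) * (cos y + sin y)"
  let ?f = "\<lambda>y. layer_cut' y * ?m y"
  have "((\<lambda>y. layer_cut' y * ?m y + ?m' y * layer_cut y) has_integral
      layer_cut 1 * ?m 1 - layer_cut 0 * ?m 0) {0..1}"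
  proof (rule fundamental_theorem_of_calculus)
    fix y :: real
    have "(?m has_real_derivative ?m' y) (at y)"
      by (auto intro!: derivative_eq_intros simp: algebra_simps)
    from DERIV_mult[OF has_real_derivative_layer_cut this]
    show "((\<lambda>y. layer_cut y * ?m y) has_vector_derivative layer_cut' y * ?m y + ?m' y * layer_cut y)
        (at y within {0..1})"
      by (simp add: has_real_derivative_iff_has_vector_derivative has_vector_derivative_at_within)
  qed simp
  moreover have "layer_cut 1 = 0" "layer_cut 0 = 0" by (auto intro: layer_cut_outside)
  ultimately have sum: "((\<lambda>y. ?f y + ?m' y * layer_cut y) has_integral 0) {0..1}" by simp
  have "((\<lambda>y. ?m' y * layer_cut y) has_integral layer_constant) {0..1}"
    unfolding layer_constant_def
    by (subst mult.commute, rule integrable_integral, rule integrable_continuous_real)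
      (intro continuous_intros)
  from has_integral_diff[OF sum this] have "(?f has_integral - layer_constant) {0..1}" by simp
  moreover have "continuous_on {0..1} ?f" by (intro continuous_intros)
  ultimately have "(LINT y:{0<..<1}|lborel. ?f y) = - layer_constant"
    by (rule has_integral_imp_set_integral_Ioo)
  moreover have "indicator {0<..<1} y *\<^sub>R ?f y = ?f y" for y
    using layer_cut'_outside[of y] by (cases "y \<in> {1/4<..<1}") (auto simp: indicator_def)
  ultimately show ?thesis unfolding set_lebesgue_integral_def by (simp only:)
qed

text \<open>
  Supported in the ball of radius \<open>1/5\<close>; together with heights at most \<open>1/4\<close> this stays inside the half ball of
  radius \<open>1/2\<close>.
\<close>

definition tangential_cut :: "real ^ 'm \<Rightarrow> real" where
  "tangential_cut y = bump (1/25 - y \<bullet> y)"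

lemma tangential_cut_outside: "1/5 \<le> norm y \<Longrightarrow> tangential_cut y = 0"
proof -
  assume "1/5 \<le> norm y"
  then have "(1/5)\<^sup>2 \<le> (norm y)\<^sup>2" by (intro power_mono) auto
  then have "1/25 \<le> y \<bullet> y" by (simp add: power2_norm_eq_inner power2_eq_square[of "1/5"])
  then show ?thesis by (simp add: tangential_cut_def bump_eq_0)
qed

lemma continuous_on_tangential_cut [continuous_intros]:
  "continuous_on S f \<Longrightarrow> continuous_on S (\<lambda>z. tangential_cut (f z))"
  unfolding tangential_cut_def by (intro continuous_intros)

lemma tangential_cut_nonneg: "0 \<le> tangential_cut y" and tangential_cut_le_1: "tangential_cut y \<le> 1"
  unfolding tangential_cut_def by (rule bump_nonneg bump_le_1)+

lemma integrable_tangential_cut: "integrable lborel (tangential_cut :: real ^ 'm::finite \<Rightarrow> real)"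
proof (rule integrable_lborel_bounded_on_ball)
  show "(tangential_cut :: real ^ 'm \<Rightarrow> real) \<in> borel_measurable borel"
    by (intro borel_measurable_continuous_onI continuous_intros)
  show "\<bar>tangential_cut (z :: real ^ 'm)\<bar> \<le> 1" for z
    using tangential_cut_nonneg[of z] tangential_cut_le_1[of z] by simp
  show "tangential_cut z = 0" if "1/5 < norm z" for z :: "real ^ 'm"
    using that by (intro tangential_cut_outside) simp
qed

lemma integral_tangential_cut_pos: "0 < (\<integral>y. tangential_cut y \<partial>(lborel :: (real ^ 'm::finite) measure))"
proof -
  let ?B = "ball (0 :: real ^ 'm) (1/10)"
  have Bint: "integrable lborel (\<lambda>y. bump (3/100) * indicator ?B y)"
    using emeasure_lborel_ball_finite[of "0 :: real ^ 'm" "1/10"]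
    by (intro integrable_mult_right) (auto intro!: integrable_real_indicator)
  have "0 < bump (3/100) * measure lborel ?B" by (intro mult_pos_pos bump_pos content_ball_pos) auto
  also have "\<dots> = (\<integral>y. bump (3/100) * indicator ?B y \<partial>lborel)" by simp
  also have "\<dots> \<le> (\<integral>y. tangential_cut y \<partial>(lborel :: (real ^ 'm) measure))"
  proof (rule integral_mono[OF Bint integrable_tangential_cut])
    fix y :: "real ^ 'm"
    show "bump (3/100) * indicator ?B y \<le> tangential_cut y"
    proof (cases "y \<in> ?B")
      case True
      then have "(norm y)\<^sup>2 \<le> (1/10)\<^sup>2" by (intro power_mono) auto
      then have "3/100 \<le> 1/25 - y \<bullet> y" by (simp add: power2_norm_eq_inner power2_eq_square[of "1/10"])
      then show ?thesis using True by (simp add: tangential_cut_def bump_mono)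
    qed (simp add: tangential_cut_nonneg)
  qed
  finally show ?thesis .
qed

text \<open>
  Smooth functions with compact support in \<open>(3/4, 1)\<close> that increase to its indicator as \<open>m\<close> grows, so that
  the exact orthogonality on this interval is recovered in the limit.
\<close>

definition time_cut :: "nat \<Rightarrow> real \<Rightarrow> real" where
  "time_cut m t = bump (real m * (t - 3/4) - 1) * bump (real m * (1 - t) - 1)"

lemma continuous_on_time_cut [continuous_intros]:
  "continuous_on S f \<Longrightarrow> continuous_on S (\<lambda>z. time_cut m (f z))"
  unfolding time_cut_def by (intro continuous_intros)

lemma time_cut_nonneg: "0 \<le> time_cut m y" and time_cut_le_1: "time_cut m y \<le> 1"
  unfolding time_cut_def by (auto intro: mult_le_one bump_nonneg bump_le_1 mult_nonneg_nonneg)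

lemma time_cut_outside:
  assumes "0 < m" "t \<notin> {3/4 + 1 / real m..1 - 1 / real m}"
  shows "time_cut m t = 0"
proof -
  have "real m * (t - 3/4) - 1 \<le> 0 \<or> real m * (1 - t) - 1 \<le> 0"
    using assms by (auto simp: field_simps)
  then show ?thesis by (auto simp: time_cut_def bump_eq_0)
qed

lemma time_cut_tendsto: "t \<in> {3/4<..<1} \<Longrightarrow> (\<lambda>m. time_cut m t) \<longlonglongrightarrow> 1"
proof -
  assume t: "t \<in> {3/4<..<1}"
  have lim: "(\<lambda>m. bump (real m * c - 1)) \<longlonglongrightarrow> 1" if "0 < c" for c
  proof (rule filterlim_compose[OF bump_tendsto_1])
    have "filterlim (\<lambda>m. real m * c) at_top sequentially"
      using that by (rule filterlim_at_top_mult_tendsto_pos[OF tendsto_const _ filterlim_real_sequentially])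
    then show "filterlim (\<lambda>m. real m * c - 1) at_top sequentially"
      using filterlim_tendsto_add_at_top[OF tendsto_const[of "-1"]] by fastforce
  qed
  have "(\<lambda>m. bump (real m * (t - 3/4) - 1) * bump (real m * (1 - t) - 1)) \<longlonglongrightarrow> 1 * 1"
    using t by (intro tendsto_mult lim) auto
  then show ?thesis by (simp add: time_cut_def)
qed

lemma abs_tangential_cut_le: "\<bar>tangential_cut y\<bar> \<le> 1"
  using tangential_cut_nonneg[of y] tangential_cut_le_1[of y] by simp

lemma abs_time_cut_le: "\<bar>time_cut m t\<bar> \<le> 1"
  using time_cut_nonneg[of m t] time_cut_le_1[of m t] by simp

section \<open>The gradient is not p-integrable\<close>

text \<open>
  The test function oscillates in time with the mode of wave number \<open>l\<close> and is supported in its layer;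
  \<open>gradient_test_normal\<close> is its derivative in the normal direction.
\<close>

definition gradient_test :: "nat \<Rightarrow> real \<Rightarrow> ('m::finite) pt \<times> real \<Rightarrow> real" where
  "gradient_test m l z =
    tangential_cut (fst (fst z)) * layer_cut (l * snd (fst z)) * (time_cut m (snd z) * cos (2 * l\<^sup>2 * snd z))"

definition gradient_test_normal :: "nat \<Rightarrow> real \<Rightarrow> ('m::finite) pt \<times> real \<Rightarrow> real" where
  "gradient_test_normal m l z =
    tangential_cut (fst (fst z)) * (l * layer_cut' (l * snd (fst z))) * (time_cut m (snd z) * cos (2 * l\<^sup>2 * snd z))"

lemma half_cyl_half: "half_cyl (1/2) = half_ball (1/2) \<times> {3/4<..<1}"
  by (simp add: half_cyl_def power2_eq_square)

lemma open_half_cyl: "open (half_cyl r)"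
  unfolding half_cyl_def by (intro open_Times open_half_ball open_greaterThanLessThan)

lemma gradient_test_smooth:
  assumes W: "open W"
  shows "Ck_on k W (gradient_test m l :: ('m::finite) pt \<times> real \<Rightarrow> real)"
proof -
  have blx: "bounded_linear (\<lambda>z :: 'm pt \<times> real. snd (fst z))"
    and blt: "bounded_linear (\<lambda>z :: 'm pt \<times> real. snd z)"
    and bly: "bounded_linear (\<lambda>z :: 'm pt \<times> real. fst (fst z))"
    by (rule bounded_linear_compose[OF bounded_linear_snd bounded_linear_fst] bounded_linear_snd
        bounded_linear_compose[OF bounded_linear_fst bounded_linear_fst])+
  note aff = Ck_on_affine[OF W]
  \<comment> \<open>Every argument is rewritten as a constant plus a multiple of a bounded linear or quadratic function.\<close>
  have eq: "gradient_test m l = (\<lambda>z :: 'm pt \<times> real.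
      bump (1/25 + (-1) * (fst (fst z) \<bullet> fst (fst z)))
      * (bump (- (1/4) + l * snd (fst z)) * bump (1 + (- l) * snd (fst z)))
      * (bump (- (real m * (3/4)) - 1 + real m * snd z) * bump (real m - 1 + (- real m) * snd z)
        * cos (0 + 2 * l\<^sup>2 * snd z)))"
    by (simp add: fun_eq_iff gradient_test_def tangential_cut_def layer_cut_def time_cut_def algebra_simps)
  show ?thesis
    unfolding eq
    by (intro Ck_on_mult[OF W] Ck_on_bump[OF W] Ck_on_cos[OF W] aff[OF blx] aff[OF blt]
        Ck_on_add[OF W] Ck_on_const[OF W] Ck_on_inner_linear[OF W bly])
qed

lemma gradient_test_support:
  assumes "4 \<le> l" "0 < m"
  shows "compact_support_in (half_cyl (1/2)) (gradient_test m l :: ('m::finite) pt \<times> real \<Rightarrow> real)"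
proof -
  let ?K = "(cball (0 :: real ^ 'm) (1/5) \<times> {1 / (4 * l)..1 / l}) \<times> {3/4 + 1 / real m..1 - 1 / real m}"
  have "compact ?K" by (intro compact_Times compact_cball compact_Icc)
  moreover have "?K \<subseteq> half_cyl (1/2)"
  proof
    fix z assume z: "z \<in> ?K"
    have l: "1 / l \<le> 1/4" "0 < 1 / (4 * l)" using assms by (auto simp: field_simps)
    have "1 / (4 * l) \<le> snd (fst z)" "snd (fst z) \<le> 1 / l" "norm (fst (fst z)) \<le> 1/5"
      using z by auto
    then have zb: "0 < snd (fst z)" "snd (fst z) \<le> 1/4" "norm (fst (fst z)) \<le> 1/5"
      using l by linarith+
    have "norm (fst z) \<le> norm (fst (fst z)) + norm (snd (fst z))"
      using norm_Pair_le[of "fst (fst z)" "snd (fst z)"] by simp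
    also have "\<dots> < 1/2" using zb by simp
    finally have "norm (fst z) < 1/2" .
    moreover have "3/4 + 1 / real m \<le> snd z" "snd z \<le> 1 - 1 / real m" using z by auto
    moreover have "0 < 1 / real m" using assms by simp
    then have "3/4 < snd z" "snd z < 1" using calculation(2,3) by linarith+
    ultimately show "z \<in> half_cyl (1/2)"
      unfolding half_cyl_half half_ball_def mem_Times_iff using zb by simp
  qed
  moreover have "gradient_test m l z = 0" if outside: "z \<notin> ?K" for z
  proof -
    consider "fst (fst z) \<notin> cball 0 (1/5)" | "snd (fst z) \<notin> {1 / (4 * l)..1 / l}"
      | "snd z \<notin> {3/4 + 1 / real m..1 - 1 / real m}"
      using outside unfolding mem_Times_iff by blast
    then show ?thesis
    proof cases
      case 1 then show ?thesis by (simp add: gradient_test_def tangential_cut_outside)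
    next
      case 2
      then have "l * snd (fst z) \<notin> {1/4<..<1}" using assms by (auto simp: field_simps)
      then have "layer_cut (l * snd (fst z)) = 0" by (rule layer_cut_outside)
      then show ?thesis by (simp add: gradient_test_def)
    next
      case 3 then show ?thesis using time_cut_outside[OF assms(2)] by (simp add: gradient_test_def)
    qed
  qed
  ultimately show ?thesis unfolding compact_support_in_def by blast
qed

lemma gradient_test_normal_deriv:
  fixes z :: "('m::finite) pt \<times> real"
  assumes W: "open W" "z \<in> W"
  shows "space_deriv W (0, 1) (gradient_test m l) z = gradient_test_normal m l z"
proof -
  let ?v = "((0, 1), 0) :: 'm pt \<times> real"
  have "gradient_test m l differentiable_on W"
    using gradient_test_smooth[OF W(1), of "Suc 0"] by simp
  then have "((\<lambda>\<tau>. gradient_test m l (z + \<tau> *\<^sub>R ?v)) has_real_derivative dir_deriv W ?v (gradient_test m l) z) (at 0)"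
    unfolding has_real_derivative_iff_has_vector_derivative
    by (intro has_vector_derivative_along_line has_derivative_dir_deriv[OF W order.refl])
  moreover have "((\<lambda>\<tau>. gradient_test m l (z + \<tau> *\<^sub>R ?v)) has_real_derivative gradient_test_normal m l z) (at 0)"
  proof -
    have "((\<lambda>\<tau>. layer_cut (l * (snd (fst z) + \<tau>))) has_real_derivative layer_cut' (l * (snd (fst z) + 0)) * l) (at 0)"
      by (rule DERIV_chain2[OF has_real_derivative_layer_cut]) (auto intro!: derivative_eq_intros)
    from DERIV_cmult[OF DERIV_cmult_right[OF this, of "time_cut m (snd z) * cos (2 * l\<^sup>2 * snd z)"],
        of "tangential_cut (fst (fst z))"]
    show ?thesis by (simp add: gradient_test_def gradient_test_normal_def ac_simps)
  qed
  ultimately show ?thesis unfolding space_deriv_def by (rule DERIV_unique)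
qed

lemma abs_gradient_test_le: "\<bar>gradient_test m l z\<bar> \<le> 1"
proof -
  have "\<bar>gradient_test m l z\<bar> = tangential_cut (fst (fst z)) * layer_cut (l * snd (fst z))
      * (time_cut m (snd z) * \<bar>cos (2 * l\<^sup>2 * snd z)\<bar>)"
    by (simp add: gradient_test_def abs_mult tangential_cut_nonneg layer_cut_nonneg time_cut_nonneg)
  also have "\<dots> \<le> 1"
    by (intro mult_le_one mult_nonneg_nonneg) (auto intro: tangential_cut_nonneg layer_cut_nonneg time_cut_nonneg
        tangential_cut_le_1 layer_cut_le_1 time_cut_le_1 abs_cos_le_one)
  finally show ?thesis .
qed

lemma bounded_half_cyl: "bounded (half_cyl r)"
proof -
  have "half_ball r \<subseteq> ball 0 r" by (auto simp: half_ball_def)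
  then show ?thesis unfolding half_cyl_def
    by (intro bounded_Times bounded_subset[OF bounded_ball, of _ 0 r] bounded_Ioo) auto
qed

text \<open>
  Splitting at the level \<open>M\<close> replaces Hoelder's inequality in the next estimate.
\<close>

lemma le_level_plus_powr:
  fixes y M p :: real
  assumes "0 \<le> y" "0 < M" "1 < p"
  shows "y \<le> M + M powr (1 - p) * y powr p"
proof (cases "y \<le> M")
  case False
  then have "y = y powr (1 - p) * y powr p" using assms by (simp flip: powr_add)
  also have "\<dots> \<le> M powr (1 - p) * y powr p"
    using False assms by (intro mult_right_mono powr_mono2') auto
  finally show ?thesis using assms by simp
next
  case True
  have "0 \<le> M powr (1 - p) * y powr p" by simp
  with True show ?thesis by linarith
qed

text \<open>
  A function in \<open>L\<^sup>p\<close> with \<open>p > 1\<close> has little mass in a thin layer: below the level \<open>M\<close> it contributes at most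
  \<open>M\<close> times the volume of the layer, which is of order \<open>1 / l\<close>, and above it at most \<open>M\<^sup>1\<^sup>-\<^sup>p\<close> times its
  total \<open>p\<close>-th power.
\<close>

lemma norm_integral_layer_le:
  fixes G :: "('m::finite) pt \<times> real \<Rightarrow> 'm pt" and \<phi> :: "'m pt \<times> real \<Rightarrow> real"
  defines "W \<equiv> half_cyl (1/2)"
  assumes G: "in_Lp p W G" and p: "1 < p" and l: "0 < l" and M: "0 < M"
    and \<phi>: "continuous_on UNIV \<phi>" "\<And>z. \<bar>\<phi> z\<bar> \<le> 1" "\<And>z. 1 \<le> l * snd (fst z) \<Longrightarrow> \<phi> z = 0"
  shows "norm (LINT z:W|lebesgue. \<phi> z *\<^sub>R G z)
    \<le> measure lborel (ball (0 :: real ^ 'm) (1/2)) * (M / l)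
      + (LINT z:W|lebesgue. norm (G z) powr p) * M powr (1 - p)"
proof -
  let ?S = "(ball (0 :: real ^ 'm) (1/2) \<times> {0<..<1 / l}) \<times> {3/4<..<1::real}"
  let ?N = "\<lambda>z. indicator W z *\<^sub>R (norm (G z) powr p)"
  have S: "?S \<in> sets borel" by (intro borel_open open_Times) auto
  have Sint: "integrable lebesgue (indicator ?S :: _ \<Rightarrow> real)"
    using S by (subst integrable_completion) (auto intro!: integrable_indicator_bounded bounded_Times)
  have Sval: "(\<integral>z. indicator ?S z \<partial>lebesgue) = measure lborel (ball (0 :: real ^ 'm) (1/2)) * (1 / l) * (1/4)"
  proof -
    have "(\<integral>z. indicator ?S z \<partial>lebesgue) = measure lborel ?S"
      using S by (subst integral_completion) auto
    also have "\<dots> = measure lborel (ball (0 :: real ^ 'm) (1/2)) * (1 / l) * (1/4)"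
      using l by (subst measure_lborel_Times, auto intro!: borel_open open_Times)
        (subst measure_lborel_Times, auto)
    finally show ?thesis .
  qed
  have Nint: "integrable lebesgue ?N" using G by (simp add: in_Lp_def set_integrable_def)
  have dom: "norm (indicator W z *\<^sub>R (\<phi> z *\<^sub>R G z)) \<le> M * indicator ?S z + M powr (1 - p) * ?N z" for z
  proof (cases "z \<in> W \<and> l * snd (fst z) < 1")
    case True
    have "norm (fst (fst z)) \<le> norm (fst z)" using norm_fst_le[of "fst (fst z)" "snd (fst z)"] by simp
    then have "z \<in> ?S"
      using True l by (auto simp: W_def half_cyl_half half_ball_def mem_Times_iff field_simps)
    moreover have "\<bar>\<phi> z\<bar> * norm (G z) \<le> 1 * norm (G z)" by (intro mult_right_mono \<phi>) auto
    ultimately show ?thesis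
      using le_level_plus_powr[of "norm (G z)" M p] True p M by simp
  next
    case False
    then have "indicator W z *\<^sub>R (\<phi> z *\<^sub>R G z) = 0" using \<phi>(3)[of z] by (auto simp: indicator_def)
    moreover have "0 \<le> M * indicator ?S z + M powr (1 - p) * ?N z"
      using M by (intro add_nonneg_nonneg mult_nonneg_nonneg) auto
    ultimately show ?thesis by (simp only: norm_zero)
  qed
  have Gm: "(\<lambda>z. indicator W z *\<^sub>R G z) \<in> borel_measurable lebesgue"
    using G by (simp add: in_Lp_def set_borel_measurable_def)
  have "\<phi> \<in> borel_measurable lebesgue"
    by (intro measurable_completion) (use borel_measurable_continuous_onI[OF \<phi>(1)] in simp)
  then have "(\<lambda>z. \<phi> z *\<^sub>R (indicator W z *\<^sub>R G z)) \<in> borel_measurable lebesgue"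
    by (intro borel_measurable_scaleR Gm)
  then have fm: "(\<lambda>z. indicator W z *\<^sub>R (\<phi> z *\<^sub>R G z)) \<in> borel_measurable lebesgue"
    by (simp only: scaleR_left_commute)
  have gint: "integrable lebesgue (\<lambda>z. M * indicator ?S z + M powr (1 - p) * ?N z)"
    by (intro Bochner_Integration.integrable_add integrable_mult_right Sint Nint)
  have fint: "integrable lebesgue (\<lambda>z. indicator W z *\<^sub>R (\<phi> z *\<^sub>R G z))"
    by (rule Bochner_Integration.integrable_bound[OF gint fm])
      (use dom in \<open>auto intro!: AE_I2 order_trans[OF _ abs_ge_self] simp del: real_scaleR_def\<close>)
  have "norm (LINT z:W|lebesgue. \<phi> z *\<^sub>R G z) \<le> (\<integral>z. M * indicator ?S z + M powr (1 - p) * ?N z \<partial>lebesgue)"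
    unfolding set_lebesgue_integral_def
    by (rule Bochner_Integration.integral_norm_bound_integral[OF fint gint dom])
  also have "\<dots> = M * (measure lborel (ball (0 :: real ^ 'm) (1/2)) * (1 / l) * (1/4))
      + M powr (1 - p) * (LINT z:W|lebesgue. norm (G z) powr p)"
    unfolding set_lebesgue_integral_def Sval[symmetric]
    using Bochner_Integration.integral_add[OF integrable_mult_right[OF Sint] integrable_mult_right[OF Nint]]
    by (simp only: integral_mult_right_zero)
  also have "\<dots> \<le> measure lborel (ball (0 :: real ^ 'm) (1/2)) * (M / l)
      + (LINT z:W|lebesgue. norm (G z) powr p) * M powr (1 - p)"
    using M l by (simp add: field_simps)
  finally show ?thesis .
qed


text \<open>
  The integrand is a product in the tangential variables, and the time integral is the \<open>k\<close>-th mode alone.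
  Substituting \<open>y = l x\<close> in the normal variable cancels the factor \<open>l\<close> from the normal derivative, so the
  result is a constant times the weight \<open>2\<^sup>-\<^sup>k\<close>, uniformly in the wave number.
\<close>

lemma integral_layer_shear:
  fixes k r :: nat
  defines "l \<equiv> freq r k" and "W \<equiv> half_cyl (1/2) :: (('m::finite) pt \<times> real) set"
  assumes r: "0 < r" and l: "4 \<le> l"
  shows "(LINT z:W|lborel. tangential_cut (fst (fst z)) * (l * layer_cut' (l * snd (fst z)))
        * (cos (2 * l\<^sup>2 * snd z) * shear (freq r) (snd (fst z)) (snd z)))
    = - ((1/2) ^ k / 8 * layer_constant * (\<integral>y. tangential_cut y \<partial>(lborel :: (real ^ 'm) measure)))"
proof -
  let ?a = "tangential_cut :: real ^ 'm \<Rightarrow> real"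
  let ?b = "\<lambda>x. l * layer_cut' (l * x)"
  let ?c = "\<lambda>x t. cos (2 * l\<^sup>2 * t) * shear (freq r) x t"
  let ?d = "\<lambda>x. (1/2) ^ k * ((1 - exp (- (l * x)) * cos (l * x)) / 8)"
  define f where "f z = ?a (fst (fst z)) * ?b (snd (fst z)) * ?c (snd (fst z)) (snd z)" for z :: "'m pt \<times> real"
  define H where "H z = indicator W z *\<^sub>R f z" for z
  obtain B where B: "0 \<le> B" "\<And>y. \<bar>layer_cut' y\<bar> \<le> B" by (rule layer_cut'_bounded) blast
  have W0: "0 \<le> snd (fst z)" if "z \<in> W" for z
    using that by (auto simp: W_def half_cyl_half half_ball_def)
  have lpos: "0 < l" using l by simp
  have b0: "?b x = 0" if "x \<notin> {0<..<1/4}" for x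
  proof -
    have "l * x \<notin> {1/4<..<1}"
    proof
      assume "l * x \<in> {1/4<..<1}"
      then have "0 < l * x" "l * x < 1" by auto
      then have "0 < x" using lpos by (simp add: zero_less_mult_iff)
      moreover have "4 * x \<le> l * x" using l \<open>0 < x\<close> by (intro mult_right_mono) auto
      moreover have "1/4 \<le> x" using that \<open>0 < x\<close> by auto
      ultimately show False using \<open>l * x < 1\<close> by linarith
    qed
    then have "layer_cut' (l * x) = 0" by (rule layer_cut'_outside)
    then show ?thesis by simp
  qed
  have Hm: "H \<in> borel_measurable borel"
    unfolding H_def[abs_def] f_def
    by (rule borel_measurable_continuous_on_indicator)
      (auto simp: W_def intro!: borel_open open_half_cyl continuous_intros continuous_on_shear freq_nonneg W0[unfolded W_def])
  have Hb: "\<bar>H z\<bar> \<le> l * B * 4" for z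
  proof (cases "z \<in> W")
    case True
    have "\<bar>f z\<bar> \<le> (1 * (l * B)) * (1 * 4)"
      unfolding f_def abs_mult using lpos B W0[OF True]
      by (intro mult_mono abs_cos_le_one abs_shear_le freq_nonneg abs_tangential_cut_le) auto
    then show ?thesis using True by (simp add: H_def)
  next
    case False
    then show ?thesis using lpos B by (simp add: H_def)
  qed
  obtain R where R: "\<And>z. z \<in> W \<Longrightarrow> norm z \<le> R"
    using bounded_half_cyl[of "1/2"] unfolding W_def bounded_iff by blast
  have "integrable lborel H"
    by (rule integrable_lborel_bounded_on_ball[OF Hm Hb, of R]) (use R in \<open>fastforce simp: H_def indicator_def\<close>)
  then have Hint: "integrable (lborel \<Otimes>\<^sub>M lborel) H" by (simp add: lborel_prod)
  have slice: "(\<integral>t. H (p, t) \<partial>lborel) = ?a (fst p) * (?b (snd p) * ?d (snd p))" for p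
  proof (cases "fst p \<in> ball 0 (1/5) \<and> snd p \<in> {0<..<1/4}")
    case True
    have "norm p \<le> norm (fst p) + norm (snd p)" using norm_Pair_le[of "fst p" "snd p"] by simp
    then have "norm p < 1/2" using True by auto
    then have "H (p, t) = ?a (fst p) * ?b (snd p) * (indicator {3/4<..<1} t *\<^sub>R ?c (snd p) t)" for t
      using True by (auto simp: H_def f_def W_def half_cyl_half half_ball_def indicator_def)
    then have "(\<integral>t. H (p, t) \<partial>lborel)
        = ?a (fst p) * ?b (snd p) * (LINT t:{3/4<..<1}|lborel. ?c (snd p) t)"
      by (simp only: integral_mult_right_zero set_lebesgue_integral_def)
    also have "(LINT t:{3/4<..<1}|lborel. ?c (snd p) t) = ?d (snd p)"
      unfolding l_def by (rule integral_cos_shear[OF r]) (use True in auto)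
    finally show ?thesis by simp
  next
    case False
    then have "?a (fst p) = 0 \<or> ?b (snd p) = 0" using b0 tangential_cut_outside by (auto simp: not_less)
    then show ?thesis by (auto simp: H_def f_def)
  qed
  have "(LINT z:W|lborel. f z) = (\<integral>z. H z \<partial>(lborel \<Otimes>\<^sub>M lborel))"
    by (simp add: set_lebesgue_integral_def H_def lborel_prod)
  also have "\<dots> = (\<integral>p. ?a (fst p) * (?b (snd p) * ?d (snd p)) \<partial>lborel)"
    using lborel_pair.integral_fst'[OF Hint] by (simp only: slice)
  also have "\<dots> = (\<integral>y. \<integral>x. ?a y * (?b x * ?d x) \<partial>lborel \<partial>lborel)"
  proof -
    have "integrable lborel (\<lambda>p. ?a (fst p) * (?b (snd p) * ?d (snd p)))"
      using lborel_pair.integrable_fst'[OF Hint] by (simp only: slice)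
    then show ?thesis
      using lborel_pair.integral_fst'[of "\<lambda>p. ?a (fst p) * (?b (snd p) * ?d (snd p))"]
      by (simp add: lborel_prod)
  qed
  also have "\<dots> = (\<integral>y. ?a y \<partial>lborel) * (\<integral>x. ?b x * ?d x \<partial>lborel)"
    by (simp only: integral_mult_right_zero integral_mult_left_zero)
  also have "(\<integral>x. ?b x * ?d x \<partial>lborel)
      = (1/2) ^ k / 8 * (l * (\<integral>x. layer_cut' (l * x) * (1 - exp (- (l * x)) * cos (l * x)) \<partial>lborel))"
    unfolding integral_mult_right_zero[symmetric]
    by (intro Bochner_Integration.integral_cong) auto
  also have "l * (\<integral>x. layer_cut' (l * x) * (1 - exp (- (l * x)) * cos (l * x)) \<partial>lborel) = - layer_constant"
    using lborel_integral_real_affine[of l "\<lambda>y. layer_cut' y * (1 - exp (- y) * cos y)" 0] lpos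
    by (simp add: integral_layer_cut')
  finally show ?thesis unfolding f_def by (simp add: mult.commute)
qed

lemma half_cyl_half_nonneg: "z \<in> half_cyl (1/2) \<Longrightarrow> 0 \<le> snd (fst z)"
  by (auto simp: half_cyl_half half_ball_def)

lemma gradient_test_normal_dominated:
  assumes l: "0 < l" and \<kappa>: "\<And>k. 0 \<le> \<kappa> k"
    and z: "z \<in> half_cyl (1/2)" and B: "\<And>y. \<bar>layer_cut' y\<bar> \<le> B"
  shows "\<bar>gradient_test_normal m l z * shear \<kappa> (snd (fst z)) (snd z)\<bar> \<le> l * B * 4"
proof -
  have "0 \<le> B" using B[of 0] by linarith
  then have "\<bar>gradient_test_normal m l z * shear \<kappa> (snd (fst z)) (snd z)\<bar> \<le> ((1 * (l * B)) * (1 * 1)) * 4"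
    unfolding gradient_test_normal_def abs_mult
    using l B half_cyl_half_nonneg[OF z]
    by (intro mult_mono abs_cos_le_one abs_shear_le \<kappa> abs_tangential_cut_le abs_time_cut_le) auto
  then show ?thesis by simp
qed

lemma gradient_test_normal_measurable:
  assumes \<kappa>: "\<And>k. 0 \<le> \<kappa> k"
  shows "(\<lambda>z. indicator (half_cyl (1/2)) z *\<^sub>R (gradient_test_normal m l z * shear \<kappa> (snd (fst z)) (snd z)))
    \<in> borel_measurable lborel"
proof -
  have "continuous_on (half_cyl (1/2)) (\<lambda>z. gradient_test_normal m l z * shear \<kappa> (snd (fst z)) (snd z))"
    unfolding gradient_test_normal_def
    by (intro continuous_intros continuous_on_shear \<kappa> half_cyl_half_nonneg)
  then show ?thesis
    unfolding measurable_lborel2 by (rule borel_measurable_continuous_on_indicator[OF borel_open[OF open_half_cyl]])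
qed

lemma gradient_test_normal_integrable:
  fixes \<kappa> :: "nat \<Rightarrow> real"
  assumes l: "0 < l" and \<kappa>: "\<And>k. 0 \<le> \<kappa> k"
  shows "set_integrable lborel (half_cyl (1/2)) (\<lambda>z. gradient_test_normal m l z * shear \<kappa> (snd (fst z)) (snd z))"
proof -
  obtain B where B: "0 \<le> B" "\<And>y. \<bar>layer_cut' y\<bar> \<le> B" by (rule layer_cut'_bounded) blast
  have i: "integrable lborel (\<lambda>z. (l * B * 4) * indicator (half_cyl (1/2)) z)"
    by (intro integrable_mult_right integrable_indicator_bounded borel_open open_half_cyl bounded_half_cyl)
  show ?thesis
    unfolding set_integrable_def
  proof (rule Bochner_Integration.integrable_bound[OF i gradient_test_normal_measurable[where \<kappa> = \<kappa>, OF \<kappa>]], rule AE_I2)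
    fix z
    show "norm (indicator (half_cyl (1/2)) z *\<^sub>R (gradient_test_normal m l z * shear \<kappa> (snd (fst z)) (snd z)))
      \<le> norm ((l * B * 4) * indicator (half_cyl (1/2)) z)"
      using gradient_test_normal_dominated[where \<kappa> = \<kappa> and z = z, OF l \<kappa> _ B(2)] l B
      by (cases "z \<in> half_cyl (1/2)") auto
  qed
qed

lemma gradient_test_limit:
  fixes l :: real and W :: "(('m::finite) pt \<times> real) set"
  defines "W \<equiv> half_cyl (1/2)"
  assumes l: "0 < l" and \<kappa>: "\<And>k. 0 \<le> \<kappa> k"
  shows "(\<lambda>m. LINT z:W|lborel. gradient_test_normal m l z * shear \<kappa> (snd (fst z)) (snd z))
    \<longlonglongrightarrow> (LINT z:W|lborel. tangential_cut (fst (fst z)) * (l * layer_cut' (l * snd (fst z)))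
        * (cos (2 * l\<^sup>2 * snd z) * shear \<kappa> (snd (fst z)) (snd z)))"
proof -
  obtain B where B: "0 \<le> B" "\<And>y. \<bar>layer_cut' y\<bar> \<le> B" by (rule layer_cut'_bounded) blast
  have W0: "0 \<le> snd (fst z)" if "z \<in> W" for z
    using that by (auto simp: W_def half_cyl_half half_ball_def)
  have W: "W \<in> sets borel" unfolding W_def by (intro borel_open open_half_cyl)
  show ?thesis
    unfolding set_lebesgue_integral_def
  proof (rule integral_dominated_convergence[where w = "\<lambda>z. (l * B * 4) * indicator W z"])
    show "integrable lborel (\<lambda>z. (l * B * 4) * indicator W z)"
      using W bounded_half_cyl[of "1/2"] unfolding W_def
      by (intro integrable_mult_right integrable_indicator_bounded) auto
    have "continuous_on W (\<lambda>z. tangential_cut (fst (fst z)) * (l * layer_cut' (l * snd (fst z)))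
        * (cos (2 * l\<^sup>2 * snd z) * shear \<kappa> (snd (fst z)) (snd z)))"
      by (intro continuous_intros continuous_on_shear \<kappa> W0)
    then show "(\<lambda>z. indicator W z *\<^sub>R (tangential_cut (fst (fst z)) * (l * layer_cut' (l * snd (fst z)))
        * (cos (2 * l\<^sup>2 * snd z) * shear \<kappa> (snd (fst z)) (snd z)))) \<in> borel_measurable lborel"
      unfolding measurable_lborel2 by (rule borel_measurable_continuous_on_indicator[OF W])
    show "(\<lambda>z. indicator W z *\<^sub>R (gradient_test_normal m l z * shear \<kappa> (snd (fst z)) (snd z)))
        \<in> borel_measurable lborel" for m
      unfolding W_def by (rule gradient_test_normal_measurable[where \<kappa> = \<kappa>, OF \<kappa>])
    show "AE z in lborel. (\<lambda>m. indicator W z *\<^sub>R (gradient_test_normal m l z * shear \<kappa> (snd (fst z)) (snd z)))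
      \<longlonglongrightarrow> indicator W z *\<^sub>R (tangential_cut (fst (fst z)) * (l * layer_cut' (l * snd (fst z)))
        * (cos (2 * l\<^sup>2 * snd z) * shear \<kappa> (snd (fst z)) (snd z)))"
    proof (rule AE_I2)
      fix z
      show "(\<lambda>m. indicator W z *\<^sub>R (gradient_test_normal m l z * shear \<kappa> (snd (fst z)) (snd z)))
      \<longlonglongrightarrow> indicator W z *\<^sub>R (tangential_cut (fst (fst z)) * (l * layer_cut' (l * snd (fst z)))
        * (cos (2 * l\<^sup>2 * snd z) * shear \<kappa> (snd (fst z)) (snd z)))"
      proof (cases "z \<in> W")
        case True
        then have t: "(\<lambda>m. time_cut m (snd z)) \<longlonglongrightarrow> 1"
          by (intro time_cut_tendsto) (auto simp: W_def half_cyl_half)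
        show ?thesis unfolding gradient_test_normal_def
          by (rule tendsto_eq_intros t refl)+ simp
      qed simp
    qed
    show "AE z in lborel. norm (indicator W z *\<^sub>R (gradient_test_normal m l z * shear \<kappa> (snd (fst z)) (snd z)))
      \<le> (l * B * 4) * indicator W z" for m
    proof (rule AE_I2)
      fix z
      show "norm (indicator W z *\<^sub>R (gradient_test_normal m l z * shear \<kappa> (snd (fst z)) (snd z)))
        \<le> (l * B * 4) * indicator W z"
      proof (cases "z \<in> W")
        case True
        then show ?thesis
          using gradient_test_normal_dominated[where \<kappa> = \<kappa> and z = z, OF l \<kappa> _ B(2)]
          by (simp add: W_def)
      qed simp
    qed
  qed
qed

text \<open>
  The lower bound comes from \<open>integral_layer_shear\<close>, the upper one from \<open>norm_integral_layer_le\<close>.  The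
  upper bound does not depend on the cut-off in time, which can thus be removed by passing to the limit.
\<close>

lemma shear_flow_gradient_bound:
  fixes e :: "('m::finite) pt" and p M :: real
  assumes wg: "\<forall>i\<in>Basis. in_Lp p (half_cyl (1/2)) (G i) \<and>
      (\<forall>\<phi>::'m pt \<times> real \<Rightarrow> real. (\<forall>k. Ck_on k (half_cyl (1/2)) \<phi>) \<and> compact_support_in (half_cyl (1/2)) \<phi> \<longrightarrow>
        (LINT z:half_cyl (1/2)|lebesgue. space_deriv (half_cyl (1/2)) i \<phi> z *\<^sub>R shear_flow (freq r) e z)
          = - (LINT z:half_cyl (1/2)|lebesgue. \<phi> z *\<^sub>R G i z))"
    and e: "e \<in> Basis" and p: "1 < p" and r: "0 < r" and k: "0 < k" and M: "0 < M"
  shows "(1/2) ^ k / 8 * layer_constant * (\<integral>y. tangential_cut y \<partial>(lborel :: (real ^ 'm) measure))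
    \<le> measure lborel (ball (0 :: real ^ 'm) (1/2)) * (M / freq r k)
      + (LINT z:half_cyl (1/2)|lebesgue. norm (G (0, 1) z) powr p) * M powr (1 - p)"
    (is "?c \<le> ?bound")
proof -
  define l where "l = freq r k"
  define W where "W = (half_cyl (1/2) :: ('m pt \<times> real) set)"
  let ?v = "\<lambda>z :: 'm pt \<times> real. shear (freq r) (snd (fst z)) (snd z)"
  have l4: "4 \<le> l"
  proof -
    have "2 ^ 1 \<le> (2::real) ^ (r * k)" using r k by (intro power_increasing) (auto simp: Suc_le_eq)
    then show ?thesis using freq_ge[of r k] by (simp add: l_def)
  qed
  have oW: "open W" unfolding W_def by (rule open_half_cyl)
  have bound: "\<bar>LINT z:W|lborel. gradient_test_normal m l z * ?v z\<bar> \<le> ?bound" if m: "0 < m" for m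
  proof -
    let ?\<phi> = "gradient_test m l :: 'm pt \<times> real \<Rightarrow> real"
    have meas: "(\<lambda>z. indicator W z *\<^sub>R (gradient_test_normal m l z * ?v z)) \<in> borel_measurable lborel"
      unfolding W_def by (rule gradient_test_normal_measurable[where \<kappa> = "freq r", OF freq_nonneg])
    have int: "integrable lborel (\<lambda>z. indicator W z *\<^sub>R (gradient_test_normal m l z * ?v z))"
      unfolding W_def set_integrable_def[symmetric]
      by (rule gradient_test_normal_integrable[where \<kappa> = "freq r", OF _ freq_nonneg]) (use l4 in simp)
    have smooth: "Ck_on j W ?\<phi>" for j by (rule gradient_test_smooth[OF oW])
    have support: "compact_support_in W ?\<phi>" unfolding W_def by (rule gradient_test_support[OF l4 m])
    have "(LINT z:W|lebesgue. space_deriv W (0, 1) ?\<phi> z *\<^sub>R shear_flow (freq r) e z)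
        = (LINT z:W|lebesgue. (gradient_test_normal m l z * ?v z) *\<^sub>R e)"
      by (rule set_lebesgue_integral_cong)
        (use oW in \<open>auto simp: gradient_test_normal_deriv[OF oW] shear_flow_def intro!: borel_open\<close>)
    also have "\<dots> = (LINT z:W|lborel. gradient_test_normal m l z * ?v z) *\<^sub>R e"
    proof -
      have "integrable lebesgue (\<lambda>z. indicator W z *\<^sub>R (gradient_test_normal m l z * ?v z))"
        using int by (rule iffD2[OF integrable_completion[OF meas]])
      then show ?thesis
        unfolding set_lebesgue_integral_def integral_completion[OF meas, symmetric]
        by (simp flip: integral_scaleR_left)
    qed
    finally have "(LINT z:W|lborel. gradient_test_normal m l z * ?v z) *\<^sub>R e
        = - (LINT z:W|lebesgue. ?\<phi> z *\<^sub>R G (0, 1) z)"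
      using bspec[OF wg normal_in_Basis, THEN conjunct2, THEN spec, of ?\<phi>, folded W_def]
        smooth support by simp
    then have "norm ((LINT z:W|lborel. gradient_test_normal m l z * ?v z) *\<^sub>R e)
        = norm (LINT z:W|lebesgue. ?\<phi> z *\<^sub>R G (0, 1) z)"
      by (simp only: norm_minus_cancel)
    then have "\<bar>LINT z:W|lborel. gradient_test_normal m l z * ?v z\<bar> = norm (LINT z:W|lebesgue. ?\<phi> z *\<^sub>R G (0, 1) z)"
      using e by simp
    also have "\<dots> \<le> ?bound"
      unfolding W_def l_def[symmetric]
    proof (rule norm_integral_layer_le[OF _ p _ M])
      show "in_Lp p (half_cyl (1/2)) (G (0, 1))" using wg normal_in_Basis by blast
      show "0 < l" using l4 by simp
      show "continuous_on UNIV ?\<phi>" unfolding gradient_test_def by (intro continuous_intros)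
      show "\<bar>?\<phi> z\<bar> \<le> 1" for z by (rule abs_gradient_test_le)
      show "?\<phi> z = 0" if "1 \<le> l * snd (fst z)" for z
        using that by (simp add: gradient_test_def layer_cut_outside)
    qed
    finally show ?thesis .
  qed
  let ?J = "LINT z:W|lborel. tangential_cut (fst (fst z)) * (l * layer_cut' (l * snd (fst z)))
        * (cos (2 * l\<^sup>2 * snd z) * ?v z)"
  have J: "?J = - ?c"
    unfolding W_def l_def by (rule integral_layer_shear[OF r]) (use l4 in \<open>simp add: l_def\<close>)
  have "(\<lambda>m. LINT z:W|lborel. gradient_test_normal m l z * ?v z) \<longlonglongrightarrow> ?J"
    unfolding W_def by (rule gradient_test_limit[where \<kappa> = "freq r", OF _ freq_nonneg]) (use l4 in simp)
  then have lim: "(\<lambda>m. \<bar>LINT z:W|lborel. gradient_test_normal m l z * ?v z\<bar>) \<longlonglongrightarrow> \<bar>- ?c\<bar>"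
    unfolding J by (rule tendsto_rabs)
  have ev: "\<forall>\<^sub>F m in sequentially. \<bar>LINT z:W|lborel. gradient_test_normal m l z * ?v z\<bar> \<le> ?bound"
    using eventually_gt_at_top[of "0::nat"] by eventually_elim (rule bound)
  have "\<bar>- ?c\<bar> \<le> ?bound"
    by (rule tendsto_upperbound[OF lim ev]) simp
  then show ?thesis by linarith
qed

text \<open>
  With \<open>M = 2\<^sup>q\<^sup>k\<close> and wave numbers of size \<open>2\<^sup>(\<^sup>q\<^sup>+\<^sup>2\<^sup>)\<^sup>k\<close>, both \<open>M / l\<^sub>k\<close> and \<open>M\<^sup>1\<^sup>-\<^sup>p\<close> are at most \<open>4\<^sup>-\<^sup>k\<close>, which
  is eventually smaller than any multiple of the lower bound \<open>2\<^sup>-\<^sup>k\<close>.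
\<close>

theorem shear_flow_gradient_not_in_Lp:
  fixes e :: "('m::finite) pt" and p :: real
  assumes p: "1 < p" and e: "e \<in> Basis" and q: "2 \<le> real q * (p - 1)"
  shows "\<not> weak_gradient_in_Lp p (half_cyl (1/2)) (shear_flow (freq (q + 2)) e)"
proof
  assume "weak_gradient_in_Lp p (half_cyl (1/2)) (shear_flow (freq (q + 2)) e)"
  then obtain G :: "'m pt \<Rightarrow> 'm pt \<times> real \<Rightarrow> 'm pt" where G: "\<forall>i\<in>Basis. in_Lp p (half_cyl (1/2)) (G i) \<and>
      (\<forall>\<phi>::'m pt \<times> real \<Rightarrow> real. (\<forall>k. Ck_on k (half_cyl (1/2)) \<phi>) \<and> compact_support_in (half_cyl (1/2)) \<phi> \<longrightarrow>
        (LINT z:half_cyl (1/2)|lebesgue. space_deriv (half_cyl (1/2)) i \<phi> z *\<^sub>R shear_flow (freq (q + 2)) e z)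
          = - (LINT z:half_cyl (1/2)|lebesgue. \<phi> z *\<^sub>R G i z))"
    unfolding weak_gradient_in_Lp_def by blast
  define c where "c = layer_constant * (\<integral>y. tangential_cut y \<partial>(lborel :: (real ^ 'm) measure)) / 8"
  define C where "C = measure lborel (ball (0 :: real ^ 'm) (1/2))"
  define N where "N = (LINT z:half_cyl (1/2)|lebesgue. norm (G (0, 1) z) powr p)"
  have c0: "0 < c" unfolding c_def using layer_constant_pos integral_tangential_cut_pos[where 'm = 'm] by simp
  have C0: "0 \<le> C" unfolding C_def by simp
  have N0: "0 \<le> N" unfolding N_def set_lebesgue_integral_def by (intro Bochner_Integration.integral_nonneg) simp
  have key: "c \<le> (C + N) * (1/2) ^ k" if k: "0 < k" for k
  proof -
    define M :: real where "M = 2 ^ (q * k)"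
    have M: "0 < M" by (simp add: M_def)
    have "M * 4 ^ k = 2 ^ ((q + 2) * k)"
      unfolding M_def by (simp add: power_add algebra_simps flip: power_mult_distrib)
    then have "M * 4 ^ k \<le> freq (q + 2) k" 
      using freq_ge[of "q + 2" k] zero_le_power[of "2::real" "(q + 2) * k"] by linarith
    then have 1: "M / freq (q + 2) k \<le> (1/4) ^ k"
      using freq_pos[of "q + 2" k] by (simp add: field_simps power_one_over)
    have "M powr (1 - p) = 2 powr (real k * (- (real q * (p - 1))))"
      by (simp add: M_def powr_powr algebra_simps flip: powr_realpow)
    also have "\<dots> \<le> 2 powr (real k * (- 2))"
      using q by (intro powr_mono mult_left_mono) auto
    also have "\<dots> = (1/4) ^ k"
      by (simp add: powr_minus powr_realpow power_one_over inverse_eq_divide power2_eq_square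
          flip: powr_powr power_mult_distrib)
    finally have 2: "M powr (1 - p) \<le> (1/4) ^ k" .
    have "(1/2) ^ k * c \<le> C * (M / freq (q + 2) k) + N * M powr (1 - p)"
      using shear_flow_gradient_bound[OF G e p _ k M] by (simp add: c_def C_def N_def)
    also have "\<dots> \<le> C * (1/4) ^ k + N * (1/4) ^ k"
      by (intro add_mono mult_left_mono 1 2 C0 N0)
    also have "\<dots> = (1/2) ^ k * ((C + N) * (1/2) ^ k)"
      by (simp add: algebra_simps flip: power_mult_distrib)
    finally show ?thesis by simp
  qed
  have "(\<lambda>k. (C + N) * (1/2) ^ k) \<longlonglongrightarrow> (C + N) * 0"
    by (intro tendsto_intros LIMSEQ_realpow_zero) auto
  moreover have "\<forall>\<^sub>F k in sequentially. c \<le> (C + N) * (1/2) ^ k"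
    using eventually_gt_at_top[of "0::nat"] by eventually_elim (rule key)
  ultimately have "c \<le> (C + N) * 0" by (intro tendsto_lowerbound) auto
  then show False using c0 by simp
qed

theorem theorem1p1:
  fixes p :: real
  assumes "1 < p"
  shows "(\<exists>u :: ('m::finite) pt \<times> real \<Rightarrow> 'm pt.
            very_weak_stokes u \<and>
            Linf_norm (half_cyl 1) u < \<infinity> \<and>
            \<not> weak_gradient_in_Lp p (half_cyl (1/2)) u)
       \<and> (\<exists>u :: 'm pt \<times> real \<Rightarrow> 'm pt.
            very_weak_navier_stokes u \<and>
            Linf_norm (half_cyl 1) u < \<infinity> \<and>
            \<not> weak_gradient_in_Lp p (half_cyl (1/2)) u)"
proof -
  obtain q :: nat where q: "2 / (p - 1) \<le> real q" using real_arch_simple by blast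
  then have q2: "2 \<le> real q * (p - 1)" using assms by (simp add: field_simps)
  \<comment> \<open>An index type is nonempty, so \<open>undefined\<close> names some tangential coordinate.\<close>
  define e :: "'m pt" where "e = (axis undefined 1, 0)"
  have e: "e \<in> Basis" "snd e = 0" by (auto simp: e_def Basis_prod_def)
  let ?u = "shear_flow (freq (q + 2)) e"
  have "very_weak_stokes ?u" "very_weak_navier_stokes ?u" "Linf_norm (half_cyl 1) ?u < \<infinity>"
    by (intro shear_flow_very_weak Linf_norm_shear_flow e freq_nonneg)+
  moreover have "\<not> weak_gradient_in_Lp p (half_cyl (1/2)) ?u"
    using shear_flow_gradient_not_in_Lp[OF assms e(1) q2] .
  ultimately show ?thesis by blast
qed

end
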